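(* Let $a\neq0$ be an $\mathscr{R}$-diagonal element in a $C^\ast$-probability space, let $I$ be an index set, $n\ge1$, and let $T\in\mathcal{H}^{(n)}(a,I)$. Then for every integer $m\ge1$, \[ \|T\|_{2m}\le\left[\sum_{\pi\in NC^\ast(n,m)}\bigl|\kappa_\pi[a_{n,m}]\bigr|\right]^{1/2m}\frac{1}{\|a\|_2^n}\,\|T\|_2 . \]
   Context: A $C^\ast$-probability space $(\mathscr{A},\phi)$ is a unital $C^\ast$-algebra with a faithful state; $\|x\|_{2m}=\phi[(xx^\ast)^m]^{1/2m}$, so $\|x\|_2=\phi(xx^\ast)^{1/2}$. $NC(n)$ is the set of non-crossing partitions of $\{1,\dots,n\}$. Free cumulants $\kappa_n$ are the multilinear functionals determined by $\phi(x_1\cdots x_n)=\sum_{\pi\in NC(n)}\kappa_\pi[x_1,\dots,x_n]$, where $\kappa_\pi[x_1,\dots,x_n]$ is the product over blocks $V=\{i_1<\dots<i_k\}$ of $\pi$ of $\kappa_k[x_{i_1},\dots,x_{i_k}]$. Elements are $\ast$-free if all mixed free cumulants in them and their adjoints involving at least two different indices vanish. $a$ is $\mathscr{R}$-diagonal if the only possibly non-vanishing free cumulants with arguments in $\{a,a^\ast\}$ are $\kappa_{2n}[a,a^\ast,\dots,a,a^\ast]$ and $\kappa_{2n}[a^\ast,a,\dots,a^\ast,a]$. Let $\{a_i:i\in I\}$ be $\ast$-free elements of a $C^\ast$-probability space, each with the same $\ast$-distribution as $a$. $\mathcal{H}^{(n)}(a,I)$ is the $\|\cdot\|_2$-closed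 space of all $T=\sum_{\mathbf{i}\in I^n}\lambda_{\mathbf{i}}a_{i_1}\cdots a_{i_n}$, $\lambda_{\mathbf{i}}\in\mathbb{C}$, with $\|T\|_2<\infty$ (for infinite sums the inequality is understood by $\|\cdot\|_{2m}$-limits of finite sums). $a_{n,m}$ is the list of length $2nm$ consisting of $2m$ consecutive groups of length $n$: first $n$ copies of $a$, then $n$ copies of $a^\ast$, then $n$ copies of $a$, and so on alternately. $NC^\ast(n,m)$ is the set of $\pi\in NC(2nm)$ such that every block of $\pi$ has even size and, reading the positions of the block in increasing order, the corresponding entries of $a_{n,m}$ alternate between $a$ and $a^\ast$. *)

theory Defs
  imports "HOL-Analysis.Analysis" "HOL-Library.Disjoint_Sets"
begin

section \<open>C*-probability spaces\<close>

text \<open>Unital C*-algebras. The real Banach algebra structure is inherited from the library; the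
  complex scalar multiplication is required to extend the real one.\<close>

class cstar_algebra = real_normed_algebra_1 + banach +
  fixes scaleC :: "complex \<Rightarrow> 'a \<Rightarrow> 'a" (infixr "*\<^sub>C" 75)
    and star :: "'a \<Rightarrow> 'a"
  assumes scaleC_add_right: "c *\<^sub>C (x + y) = c *\<^sub>C x + c *\<^sub>C y"
    and scaleC_add_left: "(c + d) *\<^sub>C x = c *\<^sub>C x + d *\<^sub>C x"
    and scaleC_scaleC: "c *\<^sub>C d *\<^sub>C x = (c * d) *\<^sub>C x"
    and scaleR_scaleC: "r *\<^sub>R x = complex_of_real r *\<^sub>C x"
    and mult_scaleC_left: "(c *\<^sub>C x) * y = c *\<^sub>C (x * y)"
    and mult_scaleC_right: "x * (c *\<^sub>C y) = c *\<^sub>C (x * y)"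
    and norm_scaleC: "norm (c *\<^sub>C x) = cmod c * norm x"
    and star_star: "star (star x) = x"
    and star_add: "star (x + y) = star x + star y"
    and star_scaleC: "star (c *\<^sub>C x) = cnj c *\<^sub>C star x"
    and star_mult: "star (x * y) = star y * star x"
    and norm_star_mult: "norm (star x * x) = (norm x)\<^sup>2"

definition faithful_state :: "('a::cstar_algebra \<Rightarrow> complex) \<Rightarrow> bool" where
  "faithful_state \<phi> \<longleftrightarrow>
     (\<forall>x y. \<phi> (x + y) = \<phi> x + \<phi> y) \<and>
     (\<forall>c x. \<phi> (c *\<^sub>C x) = c * \<phi> x) \<and>
     (\<forall>x. \<phi> (star x * x) \<in> \<real>\<^sub>\<ge>\<^sub>0) \<and>
     \<phi> 1 = 1 \<and>
     (\<forall>x. \<phi> (star x * x) = 0 \<longrightarrow> x = 0)"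

text \<open>\<open>even_norm \<phi> m x\<close> is the norm of \<open>x\<close> with index \<open>2 * m\<close>; the moment under the
  root is real and nonnegative, so taking the real part loses nothing.\<close>

definition even_norm :: "('a::cstar_algebra \<Rightarrow> complex) \<Rightarrow> nat \<Rightarrow> 'a \<Rightarrow> real" where
  "even_norm \<phi> m x = root (2 * m) (Re (\<phi> ((x * star x) ^ m)))"

abbreviation norm2 :: "('a::cstar_algebra \<Rightarrow> complex) \<Rightarrow> 'a \<Rightarrow> real" where
  "norm2 \<phi> x \<equiv> even_norm \<phi> 1 x"


section \<open>Non-crossing partitions and free cumulants\<close>

text \<open>Positions are numbered from \<open>0\<close> to \<open>n - 1\<close>, matching list indices.\<close>

definition NC :: "nat \<Rightarrow> nat set set set" where
  "NC n = {\<pi>. partition_on {..<n} \<pi> \<and>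
     (\<forall>V\<in>\<pi>. \<forall>W\<in>\<pi>. \<forall>i\<in>V. \<forall>j\<in>W. \<forall>k\<in>V. \<forall>l\<in>W. i < j \<and> j < k \<and> k < l \<longrightarrow> V = W)}"

lemma finite_NC: "finite (NC n)"
proof (rule finite_subset)
  show "NC n \<subseteq> Pow (Pow {..<n})"
    by (auto simp: NC_def partition_on_def)
qed simp

lemma NC_proper_block:
  assumes "\<pi> \<in> NC n - {{{..<n}}}" "V \<in> \<pi>"
  shows "V \<subset> {..<n}"
proof -
  have p: "\<Union>\<pi> = {..<n}" "disjoint \<pi>" "{} \<notin> \<pi>" and ne: "\<pi> \<noteq> {{..<n}}"
    using assms by (auto simp: NC_def partition_on_def)
  have "V \<noteq> {..<n}"
  proof
    assume V: "V = {..<n}"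
    have "W = V" if "W \<in> \<pi>" for W
    proof (rule ccontr)
      assume "W \<noteq> V"
      then have "W \<inter> V = {}"
        using p(2) that assms(2) by (auto simp: disjoint_def)
      moreover have "W \<subseteq> V"
        using p(1) that V by auto
      ultimately show False
        using p(3) that by (metis inf.absorb1)
    qed
    then have "\<pi> = {V}"
      using assms(2) by blast
    then show False
      using ne V by simp
  qed
  then show ?thesis
    using p(1) assms(2) by auto
qed

lemma length_nths_less:
  assumes "V \<subset> {..<length xs}"
  shows "length (nths xs V) < length xs"
proof -
  have "{i. i < length xs \<and> i \<in> V} = V"
    using assms by auto
  then show ?thesis
    using psubset_card_mono[OF _ assms] by (simp add: length_nths)
qed

text \<open>The arguments of a free cumulant form a list, and \<open>nths xs V\<close> lists the entries of \<open>xs\<close>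
  at the positions in \<open>V\<close> in increasing order. The recursion is the moment-cumulant formula
  (proved below) solved for the one-block partition.\<close>

function free_cumulant :: "('a::cstar_algebra \<Rightarrow> complex) \<Rightarrow> 'a list \<Rightarrow> complex" where
  "free_cumulant \<phi> xs = \<phi> (prod_list xs) -
     (\<Sum>\<pi>\<in>NC (length xs) - {{{..<length xs}}}. \<Prod>V\<in>\<pi>. free_cumulant \<phi> (nths xs V))"
  by auto
termination
proof (relation "Wellfounded.measure (\<lambda>(\<phi>, xs). length xs)")
  fix \<phi> :: "'a \<Rightarrow> complex" and xs :: "'a list" and \<pi> V
  assume "\<pi> \<in> NC (length xs) - {{{..<length xs}}}" and "V \<in> \<pi>"
  then have "length (nths xs V) < length xs"
    by (intro length_nths_less NC_proper_block)
  then show "((\<phi>, nths xs V), \<phi>, xs) \<in> Wellfounded.measure (\<lambda>(\<phi>, xs). length xs)"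
    by simp
qed simp

declare free_cumulant.simps [simp del]

definition partition_cumulant ::
    "('a::cstar_algebra \<Rightarrow> complex) \<Rightarrow> nat set set \<Rightarrow> 'a list \<Rightarrow> complex" where
  "partition_cumulant \<phi> \<pi> xs = (\<Prod>V\<in>\<pi>. free_cumulant \<phi> (nths xs V))"

lemma moment_cumulant:
  assumes "xs \<noteq> []"
  shows "\<phi> (prod_list xs) = (\<Sum>\<pi>\<in>NC (length xs). partition_cumulant \<phi> \<pi> xs)"
proof -
  let ?top = "{{..<length xs}}"
  have top: "?top \<in> NC (length xs)"
    using assms by (auto simp: NC_def partition_on_def)
  have "partition_cumulant \<phi> ?top xs = free_cumulant \<phi> xs"
    by (simp add: partition_cumulant_def nths_all)
  then show ?thesis
    using free_cumulant.simps[of \<phi> xs]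
    by (simp add: sum.remove[OF finite_NC top] partition_cumulant_def)
qed


section \<open>R-diagonal elements and *-freeness\<close>

text \<open>Words in \<open>a\<close> and \<open>star a\<close> are encoded by lists of Booleans, \<open>True\<close> marking a star.\<close>

definition letter :: "'a::cstar_algebra \<Rightarrow> bool \<Rightarrow> 'a" where
  "letter a e = (if e then star a else a)"

definition R_diagonal :: "('a::cstar_algebra \<Rightarrow> complex) \<Rightarrow> 'a \<Rightarrow> bool" where
  "R_diagonal \<phi> a \<longleftrightarrow>
     (\<forall>es. \<not> (even (length es) \<and> successively (\<noteq>) es) \<longrightarrow>
        free_cumulant \<phi> (map (letter a) es) = 0)"

definition star_free :: "('a::cstar_algebra \<Rightarrow> complex) \<Rightarrow> 'i set \<Rightarrow> ('i \<Rightarrow> 'a) \<Rightarrow> bool" where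
  "star_free \<phi> I b \<longleftrightarrow>
     (\<forall>ws :: ('i \<times> bool) list. fst ` set ws \<subseteq> I \<and> (\<exists>p\<in>set ws. \<exists>q\<in>set ws. fst p \<noteq> fst q) \<longrightarrow>
        free_cumulant \<phi> (map (\<lambda>(i, e). letter (b i) e) ws) = 0)"

definition same_star_distribution ::
    "('a::cstar_algebra \<Rightarrow> complex) \<Rightarrow> 'a \<Rightarrow> ('b::cstar_algebra \<Rightarrow> complex) \<Rightarrow> 'b \<Rightarrow> bool" where
  "same_star_distribution \<phi> a \<psi> b \<longleftrightarrow>
     (\<forall>es. \<phi> (prod_list (map (letter a) es)) = \<psi> (prod_list (map (letter b) es)))"


section \<open>The partitions NC* and the list \<open>a\<^sub>n\<^sub>,\<^sub>m\<close>\<close>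

definition pattern :: "nat \<Rightarrow> nat \<Rightarrow> bool list" where
  "pattern n m = concat (replicate m (replicate n False @ replicate n True))"

definition pattern_list :: "'a::cstar_algebra \<Rightarrow> nat \<Rightarrow> nat \<Rightarrow> 'a list" where
  "pattern_list a n m = map (letter a) (pattern n m)"

definition NC_star :: "nat \<Rightarrow> nat \<Rightarrow> nat set set set" where
  "NC_star n m = {\<pi> \<in> NC (2 * n * m).
     \<forall>V\<in>\<pi>. even (card V) \<and> successively (\<noteq>) (nths (pattern n m) V)}"


section \<open>The spaces \<open>H\<^sup>(\<^sup>n\<^sup>)(a, I)\<close>\<close>

text \<open>A completion of the algebra with respect to \<open>norm2 \<phi>\<close>, given by a dense isometric
  embedding into a Banach space. The infinite sums live in this completion.\<close>

definition L2_completion :: "('a::cstar_algebra \<Rightarrow> complex) \<Rightarrow> ('a \<Rightarrow> 'h::banach) \<Rightarrow> bool" where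
  "L2_completion \<phi> \<Lambda> \<longleftrightarrow>
     linear \<Lambda> \<and> (\<forall>x. norm (\<Lambda> x) = norm2 \<phi> x) \<and> closure (range \<Lambda>) = UNIV"

definition finite_sums :: "nat \<Rightarrow> 'i set \<Rightarrow> ('i \<Rightarrow> 'a::cstar_algebra) \<Rightarrow> 'a set" where
  "finite_sums n I b =
     {(\<Sum>w\<in>W. c w *\<^sub>C prod_list (map b w)) | W c.
        finite W \<and> W \<subseteq> {w. length w = n \<and> set w \<subseteq> I}}"

text \<open>The closure contains the sum of every convergent series of the words
  \<open>prod_list (map b w)\<close> with complex coefficients, since such a sum is a limit of finite sums.\<close>

definition H_space ::
    "('a::cstar_algebra \<Rightarrow> 'h::banach) \<Rightarrow> nat \<Rightarrow> 'i set \<Rightarrow> ('i \<Rightarrow> 'a) \<Rightarrow> 'h set" where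
  "H_space \<Lambda> n I b = closure (\<Lambda> ` finite_sums n I b)"

text \<open>The filter of elements \<open>x\<close> of \<open>X\<close> tending to \<open>T\<close> in the 2-norm. It is proper
  iff \<open>T\<close> lies in the closure of \<open>\<Lambda> ` X\<close>.\<close>

definition tending_to :: "('a \<Rightarrow> 'h::banach) \<Rightarrow> 'a set \<Rightarrow> 'h \<Rightarrow> 'a filter" where
  "tending_to \<Lambda> X T = inf (filtercomap \<Lambda> (nhds T)) (principal X)"

text \<open>For an element \<open>T\<close> of the completion, the norm with index \<open>2 * m\<close> is
  understood through limits of elements of \<open>X\<close>: any elements of \<open>X\<close> tending to \<open>T\<close> must be
  Cauchy in \<open>even_norm \<phi> m\<close>, and the norm of \<open>T\<close> is the limit of their norms.
  If \<open>T = \<Lambda> x\<close> with \<open>x \<in> X\<close>, that limit can only be \<open>even_norm \<phi> m x\<close>.\<close>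

definition even_norm_limit ::
    "('a::cstar_algebra \<Rightarrow> complex) \<Rightarrow> ('a \<Rightarrow> 'h::banach) \<Rightarrow> 'a set \<Rightarrow> nat \<Rightarrow> 'h \<Rightarrow> real \<Rightarrow> bool" where
  "even_norm_limit \<phi> \<Lambda> X m T L \<longleftrightarrow>
     ((\<lambda>(x, y). even_norm \<phi> m (x - y)) \<longlongrightarrow> 0) (tending_to \<Lambda> X T \<times>\<^sub>F tending_to \<Lambda> X T) \<and>
     (even_norm \<phi> m \<longlongrightarrow> L) (tending_to \<Lambda> X T)"

lemma even_norm_limit_finite:
  assumes "even_norm_limit \<phi> \<Lambda> X m (\<Lambda> x) L" "x \<in> X"
  shows "L = even_norm \<phi> m x"
proof -
  have "principal {x} \<le> tending_to \<Lambda> X (\<Lambda> x)"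
    using assms(2) unfolding tending_to_def
    by (auto simp: le_filter_def eventually_principal eventually_inf_principal
        eventually_filtercomap dest: eventually_nhds_x_imp_x)
  then have "(even_norm \<phi> m \<longlongrightarrow> L) (principal {x})"
    using assms(1) tendsto_mono by (auto simp: even_norm_limit_def)
  moreover have "(even_norm \<phi> m \<longlongrightarrow> even_norm \<phi> m x) (principal {x})"
    by (rule tendsto_eventually) (simp add: eventually_principal)
  moreover have "principal {x} \<noteq> bot"
    by (simp add: principal_eq_bot_iff)
  ultimately show ?thesis
    using tendsto_unique by blast
qed

lemma even_norm_limit_unique:
  assumes "T \<in> closure (\<Lambda> ` X)"
    and "even_norm_limit \<phi> \<Lambda> X m T L" "even_norm_limit \<phi> \<Lambda> X m T L'"
  shows "L = L'"
proof -
  have "tending_to \<Lambda> X T \<noteq> bot"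
  proof
    assume "tending_to \<Lambda> X T = bot"
    then have "eventually (\<lambda>x. x \<notin> X) (filtercomap \<Lambda> (nhds T))"
      by (simp add: tending_to_def trivial_limit_def eventually_inf_principal)
    then obtain P where P: "eventually P (nhds T)" "\<And>x. P (\<Lambda> x) \<Longrightarrow> x \<notin> X"
      by (auto simp: eventually_filtercomap)
    then obtain S where S: "open S" "T \<in> S" "\<And>y. y \<in> S \<Longrightarrow> P y"
      unfolding eventually_nhds by blast
    then have "(\<Lambda> ` X) \<inter> S \<noteq> {}"
      using assms(1) unfolding closure_iff_nhds_not_empty by blast
    then show False
      using S(3) P(2) by blast
  qed
  then show ?thesis
    using assms(2,3) tendsto_unique by (auto simp: even_norm_limit_def)
qed

end

theory Submission
  imports Defs
begin

text \<open>For a finite sum \<open>x\<close>, expand \<open>\<psi> ((x x\<^sup>*)\<^sup>m)\<close> by the moment-cumulant formula. Freeness and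
  R-diagonality leave only \<open>\<pi> \<in> NC\<^sup>*(n, m)\<close> and words that are constant on the blocks of \<open>\<pi>\<close>, so
  the coefficient of \<open>\<kappa>\<^sub>\<pi>\<close> is a sum over one variable per block of a product of \<open>2 m\<close>
  coefficient functions, one per group of \<open>n\<close> positions. As the letters of a block alternate,
  each block meets at least two groups, and Finner's inequality bounds this sum by the product
  of the \<open>\<ell>\<^sup>2\<close> norms. For \<open>m = 1\<close> the only partition is the rainbow, which identifies the
  \<open>\<ell>\<^sup>2\<close> norm of the coefficients with \<open>\<parallel>x\<parallel>\<^sub>2 / \<parallel>a\<parallel>\<^sub>2\<^sup>n\<close>. The same bound
  holds for alternating products of different finite sums, which makes the moment Lipschitz on
  2-norm bounded sets and gives the passage to the closure.\<close>

section \<open>Finner's inequality for sums over finite sets\<close>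

text \<open>Cauchy-Schwarz takes care of two of the factors, and each remaining factor is bounded
  pointwise by its l2 norm. This is the elimination of a single variable in Finner's
  inequality.\<close>

lemma sum_prod_le_prod_L2_set:
  fixes h :: "'g \<Rightarrow> 'x \<Rightarrow> real"
  assumes "finite G" "finite J" "card G \<ge> 2" "\<And>g x. h g x \<ge> 0"
  shows "(\<Sum>x\<in>J. \<Prod>g\<in>G. h g x) \<le> (\<Prod>g\<in>G. L2_set (h g) J)"
proof -
  obtain g1 where g1: "g1 \<in> G"
    using assms(3) by fastforce
  have "card (G - {g1}) \<noteq> 0"
    using assms(1,3) g1 by simp
  then obtain g2 where g2: "g2 \<in> G - {g1}"
    by (metis all_not_in_conv card.empty)
  define H where "H = G - {g1} - {g2}"
  have split: "prod k G = k g1 * (k g2 * prod k H)" for k :: "'g \<Rightarrow> real"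
    unfolding H_def using assms(1) g1 g2
    by (metis finite_Diff prod.remove)
  define c where "c = (\<Prod>g\<in>H. L2_set (h g) J)"
  have c0: "c \<ge> 0"
    unfolding c_def by (intro prod_nonneg) auto
  have "(\<Sum>x\<in>J. \<Prod>g\<in>G. h g x) \<le> (\<Sum>x\<in>J. \<bar>h g1 x\<bar> * \<bar>h g2 x\<bar> * c)"
  proof (rule sum_mono)
    fix x assume x: "x \<in> J"
    have "(\<Prod>g\<in>H. h g x) \<le> c"
      unfolding c_def using assms x by (intro prod_mono) (auto intro: member_le_L2_set)
    then show "(\<Prod>g\<in>G. h g x) \<le> \<bar>h g1 x\<bar> * \<bar>h g2 x\<bar> * c"
      using assms(4) by (auto simp: split mult.assoc intro!: mult_left_mono)
  qed
  also have "\<dots> \<le> L2_set (h g1) J * L2_set (h g2) J * c"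
    using L2_set_mult_ineq[of "h g1" "h g2" J] c0
    by (simp add: sum_distrib_right[symmetric] mult_right_mono)
  finally show ?thesis
    by (simp add: split c_def mult.assoc)
qed

lemma sum_PiE_insert:
  assumes "v \<notin> B"
  shows "(\<Sum>i\<in>PiE (insert v B) (\<lambda>_. J). F i) = (\<Sum>i\<in>PiE B (\<lambda>_. J). \<Sum>x\<in>J. F (i(v := x)))"
proof -
  have "(\<Sum>i\<in>PiE (insert v B) (\<lambda>_. J). F i)
      = (\<Sum>(x, i)\<in>J \<times> PiE B (\<lambda>_. J). F (i(v := x)))"
    unfolding PiE_insert_eq using inj_combinator[OF assms, of "\<lambda>_. J"]
    by (subst sum.reindex) (auto simp: case_prod_unfold)
  also have "\<dots> = (\<Sum>x\<in>J. \<Sum>i\<in>PiE B (\<lambda>_. J). F (i(v := x)))"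
    by (simp add: sum.cartesian_product)
  finally show ?thesis
    by (simp add: sum.swap[of _ J])
qed

text \<open>A discrete form of Finner's inequality, with all exponents equal to 2: since every
  variable enters at least two factors, the variables can be summed out one at a time.\<close>

lemma Finner_inequality:
  fixes f :: "'g \<Rightarrow> ('v \<Rightarrow> 'x) \<Rightarrow> real"
  assumes "finite B" "finite G" "finite J"
    and "\<And>g. g \<in> G \<Longrightarrow> S g \<subseteq> B"
    and "\<And>v. v \<in> B \<Longrightarrow> card {g \<in> G. v \<in> S g} \<ge> 2"
    and "\<And>g i. f g i \<ge> 0"
  shows "(\<Sum>i\<in>PiE B (\<lambda>_. J). \<Prod>g\<in>G. f g (restrict i (S g)))
       \<le> (\<Prod>g\<in>G. L2_set (f g) (PiE (S g) (\<lambda>_. J)))"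
  using assms(1,4-)
proof (induction B arbitrary: f S rule: finite_induct)
  \<comment> \<open>With no variables left, each function space is the singleton of
    \<open>\<lambda>_. undefined\<close>, so both sides are the same product of values.\<close>
  case empty
  have restrict_undefined: "restrict (\<lambda>_. undefined) A = (\<lambda>_. undefined :: 'x)" for A :: "'v set"
    by (simp add: restrict_def)
  have "f g (\<lambda>_. undefined) = L2_set (f g) (PiE (S g) (\<lambda>_. J))"
    if "g \<in> G" for g
    using empty that by (auto simp: L2_set_def)
  then have "(\<Prod>g\<in>G. f g (\<lambda>_. undefined))
      = (\<Prod>g\<in>G. L2_set (f g) (PiE (S g) (\<lambda>_. J)))"
    by (rule prod.cong[OF refl])
  then show ?case
    by (simp add: restrict_undefined)
next
  case (insert v B)
  define S' where "S' g = S g - {v}" for g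
  \<comment> \<open>Summing out \<open>v\<close> replaces every factor that contains
    \<open>v\<close> by its l2 norm in that coordinate and leaves the other factors alone.\<close>
  define f' where "f' g i = (if v \<in> S g then L2_set (\<lambda>x. f g (i(v := x))) J else f g i)" for g i
  let ?G1 = "{g \<in> G. v \<in> S g}" and ?G0 = "{g \<in> G. v \<notin> S g}"
  have split: "prod k G = prod k ?G1 * prod k ?G0" for k :: "'g \<Rightarrow> real"
    using assms(2) by (subst prod.union_disjoint[symmetric]) (auto intro: prod.cong)
  have step: "(\<Sum>x\<in>J. \<Prod>g\<in>G. f g (restrict (i(v := x)) (S g))) \<le> (\<Prod>g\<in>G. f' g (restrict i (S' g)))" for i
  proof -
    have 1: "restrict (i(v := x)) (S g) = (restrict i (S' g))(v := x)" if "v \<in> S g" for x g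
      using that by (auto simp: S'_def restrict_def)
    have 0: "S' g = S g" if "v \<notin> S g" for g
      using that by (auto simp: S'_def)
    have "(\<Sum>x\<in>J. \<Prod>g\<in>G. f g (restrict (i(v := x)) (S g)))
        = (\<Sum>x\<in>J. \<Prod>g\<in>?G1. f g ((restrict i (S' g))(v := x))) * (\<Prod>g\<in>?G0. f g (restrict i (S' g)))"
      by (simp add: split sum_distrib_right 0 1)
    also have "\<dots> \<le> (\<Prod>g\<in>?G1. L2_set (\<lambda>x. f g ((restrict i (S' g))(v := x))) J)
        * (\<Prod>g\<in>?G0. f g (restrict i (S' g)))"
      using assms insert.prems
      by (intro mult_right_mono sum_prod_le_prod_L2_set prod_nonneg) auto
    also have "\<dots> = (\<Prod>g\<in>G. f' g (restrict i (S' g)))"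
      by (simp add: split f'_def)
    finally show ?thesis .
  qed
  have "(\<Sum>i\<in>PiE (insert v B) (\<lambda>_. J). \<Prod>g\<in>G. f g (restrict i (S g)))
      \<le> (\<Sum>i\<in>PiE B (\<lambda>_. J). \<Prod>g\<in>G. f' g (restrict i (S' g)))"
    unfolding sum_PiE_insert[OF insert.hyps(2)] by (intro sum_mono step)
  also have "\<dots> \<le> (\<Prod>g\<in>G. L2_set (f' g) (PiE (S' g) (\<lambda>_. J)))"
  proof (rule insert.IH)
    show "S' g \<subseteq> B" if "g \<in> G" for g
      using insert.prems(1)[OF that] by (auto simp: S'_def)
    show "card {g \<in> G. w \<in> S' g} \<ge> 2" if "w \<in> B" for w
    proof -
      have "{g \<in> G. w \<in> S' g} = {g \<in> G. w \<in> S g}"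
        using that insert.hyps(2) by (auto simp: S'_def)
      then show ?thesis
        using insert.prems(2)[of w] that by simp
    qed
    show "f' g i \<ge> 0" for g i
      using insert.prems(3) by (simp add: f'_def)
  qed
  \<comment> \<open>An l2 norm of l2 norms in one coordinate is the l2 norm in all coordinates, so
    the bound for \<open>f'\<close> is already the one wanted for \<open>f\<close>.\<close>
  also have "\<dots> = (\<Prod>g\<in>G. L2_set (f g) (PiE (S g) (\<lambda>_. J)))"
  proof (rule prod.cong)
    fix g assume "g \<in> G"
    show "L2_set (f' g) (PiE (S' g) (\<lambda>_. J)) = L2_set (f g) (PiE (S g) (\<lambda>_. J))"
    proof (cases "v \<in> S g")
      case True
      then have S: "S g = insert v (S' g)" and v: "v \<notin> S' g"
        by (auto simp: S'_def)
      show ?thesis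
        unfolding S L2_set_def sum_PiE_insert[OF v]
        using True by (simp add: f'_def L2_set_def sum_nonneg)
    next
      case False
      then have "S' g = S g"
        by (auto simp: S'_def)
      then show ?thesis
        using False by (simp add: f'_def L2_set_def)
    qed
  qed simp
  finally show ?case .
qed

section \<open>Free cumulants of words\<close>

text \<open>The defining recursion expresses a cumulant through moments and cumulants of shorter
  subwords, so induction on the length applies.\<close>

lemma free_cumulant_same_star_distribution:
  assumes "same_star_distribution \<psi> b \<phi> a"
  shows "free_cumulant \<psi> (map (letter b) es) = free_cumulant \<phi> (map (letter a) es)"
proof (induction es rule: measure_induct_rule[of length])
  case (less es)
  have "(\<Prod>V\<in>\<pi>. free_cumulant \<psi> (nths (map (letter b) es) V))
      = (\<Prod>V\<in>\<pi>. free_cumulant \<phi> (nths (map (letter a) es) V))"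
    if "\<pi> \<in> NC (length es) - {{{..<length es}}}" for \<pi>
    using that by (intro prod.cong refl)
      (simp add: nths_map less length_nths_less NC_proper_block)
  then have "(\<Sum>\<pi>\<in>NC (length es) - {{{..<length es}}}.
        \<Prod>V\<in>\<pi>. free_cumulant \<psi> (nths (map (letter b) es) V))
      = (\<Sum>\<pi>\<in>NC (length es) - {{{..<length es}}}.
        \<Prod>V\<in>\<pi>. free_cumulant \<phi> (nths (map (letter a) es) V))"
    by (rule sum.cong[OF refl])
  then show ?case
    using assms
    by (simp add: free_cumulant.simps[of _ "map _ es"] same_star_distribution_def)
qed

definition words :: "nat \<Rightarrow> 'i set \<Rightarrow> 'i list set" where
  "words n J = {w. length w = n \<and> set w \<subseteq> J}"

lemma finite_words: "finite J \<Longrightarrow> finite (words n J)"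
  unfolding words_def using finite_lists_length_eq[of J n] by (simp add: conj_commute)

definition constant_on_blocks :: "nat set set \<Rightarrow> 'i list \<Rightarrow> bool" where
  "constant_on_blocks \<pi> u \<longleftrightarrow> (\<forall>V\<in>\<pi>. \<forall>p\<in>V. \<forall>q\<in>V. u ! p = u ! q)"

text \<open>Indices and stars are kept in separate lists, because the stars stay fixed while the
  index word runs through a sum.\<close>

abbreviation word_letters :: "('i \<Rightarrow> 'a::cstar_algebra) \<Rightarrow> 'i list \<Rightarrow> bool list \<Rightarrow> 'a list" where
  "word_letters b u es \<equiv> map (\<lambda>(i, e). letter (b i) e) (zip u es)"

lemma length_pattern: "length (pattern n m) = 2 * n * m"
  by (induction m) (auto simp: pattern_def)

lemma NC_D:
  assumes "\<pi> \<in> NC n"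
  shows "finite \<pi>" "\<Union>\<pi> = {..<n}" "disjoint \<pi>" "{} \<notin> \<pi>"
proof -
  show "\<Union>\<pi> = {..<n}" "disjoint \<pi>" "{} \<notin> \<pi>"
    using assms by (auto simp: NC_def partition_on_def)
  then show "finite \<pi>"
    by (metis finite_UnionD finite_lessThan)
qed

text \<open>A block that carries two indices yields a mixed cumulant, which vanishes by freeness.
  Otherwise each block involves a single \<open>b i\<close>, which may be replaced by
  \<open>a\<close>, and R-diagonality then removes every partition with a block of odd size or with
  a repeated letter.\<close>

lemma partition_cumulant_word:
  assumes "R_diagonal \<phi> a" and "star_free \<psi> I b"
    and "\<And>i. i \<in> I \<Longrightarrow> same_star_distribution \<psi> (b i) \<phi> a"
    and u: "u \<in> words (2 * n * m) I" and \<pi>: "\<pi> \<in> NC (2 * n * m)"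
  shows "partition_cumulant \<psi> \<pi> (word_letters b u (pattern n m)) =
    (if \<pi> \<in> NC_star n m \<and> constant_on_blocks \<pi> u
     then partition_cumulant \<phi> \<pi> (pattern_list a n m) else 0)"
proof (cases "constant_on_blocks \<pi> u")
  case False
  then obtain V p q where V: "V \<in> \<pi>" "p \<in> V" "q \<in> V" "u ! p \<noteq> u ! q"
    by (auto simp: constant_on_blocks_def)
  let ?zs = "nths (zip u (pattern n m)) V"
  have len: "length u = 2 * n * m" "p < 2 * n * m" "q < 2 * n * m"
    using V NC_D(2)[OF \<pi>] u by (auto simp: words_def)
  have mem: "(u ! r, pattern n m ! r) \<in> set ?zs" if "r \<in> V" "r < 2 * n * m" for r
    unfolding set_nths using that len by (auto simp: length_pattern intro!: exI[of _ r])
  have "fst ` set ?zs \<subseteq> I"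
    using u set_nths_subset[of "zip u (pattern n m)" V] set_zip_leftD
    by (fastforce simp: words_def)
  moreover have "\<exists>x\<in>set ?zs. \<exists>y\<in>set ?zs. fst x \<noteq> fst y"
    using mem[OF V(2)] mem[OF V(3)] len V(4) by force
  ultimately have "free_cumulant \<psi> (nths (word_letters b u (pattern n m)) V) = 0"
    using assms(2) by (simp add: star_free_def nths_map)
  then have "partition_cumulant \<psi> \<pi> (word_letters b u (pattern n m)) = 0"
    unfolding partition_cumulant_def using V(1) NC_D(1)[OF \<pi>] by (auto intro: prod_zero)
  then show ?thesis
    using False by simp
next
  case True
  have len: "length u = 2 * n * m"
    using u by (auto simp: words_def)
  have eq: "free_cumulant \<psi> (nths (word_letters b u (pattern n m)) V)
      = free_cumulant \<phi> (nths (pattern_list a n m) V)" if V: "V \<in> \<pi>" for V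
  proof -
    obtain p where p: "p \<in> V"
      using V NC_D(4)[OF \<pi>] by fastforce
    then have pl: "p < 2 * n * m"
      using V NC_D(2)[OF \<pi>] by auto
    define i where "i = u ! p"
    have i: "i \<in> I"
      using pl len u by (auto simp: i_def words_def subset_iff)
    let ?zs = "nths (zip u (pattern n m)) V"
    have "fst z = i" if z: "z \<in> set ?zs" for z
    proof -
      obtain r where r: "z = zip u (pattern n m) ! r" "r < length (zip u (pattern n m))" "r \<in> V"
        using z unfolding set_nths by blast
      have "u ! r = i"
        using True V p r(3) unfolding constant_on_blocks_def i_def by blast
      then show ?thesis
        using r by simp
    qed
    then have "map (\<lambda>(i, e). letter (b i) e) ?zs = map (letter (b i)) (map snd ?zs)"
      unfolding map_map by (intro map_cong) (simp_all add: case_prod_beta)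
    also have "map snd ?zs = nths (pattern n m) V"
      using len by (simp add: nths_map[symmetric] length_pattern)
    finally show ?thesis
      using free_cumulant_same_star_distribution[OF assms(3)[OF i]]
      by (simp add: nths_map pattern_list_def)
  qed
  then have *: "partition_cumulant \<psi> \<pi> (word_letters b u (pattern n m))
      = partition_cumulant \<phi> \<pi> (pattern_list a n m)"
    by (simp add: partition_cumulant_def)
  show ?thesis
  proof (cases "\<pi> \<in> NC_star n m")
    case False
    then obtain V where V: "V \<in> \<pi>"
      "\<not> (even (card V) \<and> successively (\<noteq>) (nths (pattern n m) V))"
      using \<pi> by (auto simp: NC_star_def)
    \<comment> \<open>Since \<open>V\<close> lies within the range of positions, its subword has
      length \<open>card V\<close>; thus the parity conditions of \<open>NC_star\<close> and
      \<open>R_diagonal\<close> agree.\<close>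
    have "{i. i < 2 * n * m \<and> i \<in> V} = V"
      using V(1) NC_D(2)[OF \<pi>] by auto
    then have "free_cumulant \<phi> (nths (pattern_list a n m) V) = 0"
      using V(2) assms(1)
      by (auto simp: R_diagonal_def pattern_list_def nths_map length_nths length_pattern)
    then have "partition_cumulant \<phi> \<pi> (pattern_list a n m) = 0"
      unfolding partition_cumulant_def using V(1) NC_D(1)[OF \<pi>] by (auto intro: prod_zero)
    then show ?thesis
      using False * by simp
  next
    case in_NC_star: True
    show ?thesis
      unfolding * using True in_NC_star by simp
  qed
qed

lemma word_moment:
  assumes "R_diagonal \<phi> a" and "star_free \<psi> I b"
    and "\<And>i. i \<in> I \<Longrightarrow> same_star_distribution \<psi> (b i) \<phi> a"
    and u: "u \<in> words (2 * n * m) I" and nm: "n \<ge> 1" "m \<ge> 1"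
  shows "\<psi> (prod_list (word_letters b u (pattern n m))) =
    (\<Sum>\<pi>\<in>NC_star n m. if constant_on_blocks \<pi> u
       then partition_cumulant \<phi> \<pi> (pattern_list a n m) else 0)"
proof -
  have len: "length (word_letters b u (pattern n m)) = 2 * n * m"
    using u by (simp add: words_def length_pattern)
  \<comment> \<open>The moment-cumulant formula is available for nonempty words only.\<close>
  have "2 * n * m > 0"
    using nm by simp
  then have "word_letters b u (pattern n m) \<noteq> []"
    using len by (metis less_irrefl list.size(3))
  then have "\<psi> (prod_list (word_letters b u (pattern n m))) =
      (\<Sum>\<pi>\<in>NC (2 * n * m). partition_cumulant \<psi> \<pi> (word_letters b u (pattern n m)))"
    using moment_cumulant len by metis
  also have "\<dots> = (\<Sum>\<pi>\<in>NC (2 * n * m). if \<pi> \<in> NC_star n m \<and> constant_on_blocks \<pi> u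
     then partition_cumulant \<phi> \<pi> (pattern_list a n m) else 0)"
    by (rule sum.cong[OF refl]) (rule partition_cumulant_word[OF assms(1-4)])
  also have "\<dots> = (\<Sum>\<pi>\<in>NC_star n m. if constant_on_blocks \<pi> u
       then partition_cumulant \<phi> \<pi> (pattern_list a n m) else 0)"
    by (rule sum.mono_neutral_cong_right) (auto simp: finite_NC NC_star_def)
  finally show ?thesis .
qed

section \<open>Moments of homogeneous elements\<close>

lemma scaleC_one: "1 *\<^sub>C (x :: 'a::cstar_algebra) = x"
  using scaleR_scaleC[of 1 x] by simp

lemma star_sum: "star (\<Sum>i\<in>A. f i :: 'a::cstar_algebra) = (\<Sum>i\<in>A. star (f i))"
proof -
  interpret additive "star :: 'a \<Rightarrow> 'a"
    by unfold_locales (rule star_add)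
  show ?thesis
    by (rule sum)
qed

lemma star_one: "star (1 :: 'a::cstar_algebra) = 1"
  using star_mult[of "star 1" "1 :: 'a"] by (simp add: star_star)

lemma star_prod_list: "star (prod_list xs :: 'a::cstar_algebra) = prod_list (map star (rev xs))"
  by (induction xs) (auto simp: star_one star_mult)

section \<open>Products of sums over words\<close>

definition slice :: "nat \<Rightarrow> nat \<Rightarrow> 'i list \<Rightarrow> 'i list" where
  "slice n j u = take n (drop (n * j) u)"

lemma length_slice: "j < k \<Longrightarrow> length u = n * k \<Longrightarrow> length (slice n j u) = n"
  using mult_le_mono2[of "Suc j" k n] by (auto simp: slice_def)

lemma slice_append_left:
  assumes "j < k" "length u = n * k"
  shows "slice n j (u @ w) = slice n j u"
proof -
  have "n * j + n \<le> n * k"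
    using assms mult_le_mono2[of "Suc j" k n] by simp
  then show ?thesis
    using assms by (simp add: slice_def)
qed

lemma slice_append_right: "length u = n * k \<Longrightarrow> length w = n \<Longrightarrow> slice n k (u @ w) = w"
  by (simp add: slice_def)

lemma sum_words_append:
  "(\<Sum>u\<in>words (n + k) J. f u) = (\<Sum>u\<in>words n J. \<Sum>w\<in>words k J. f (u @ w))"
proof -
  have inj: "inj_on (\<lambda>(u, w). u @ w) (words n J \<times> words k J)"
    by (auto simp: inj_on_def words_def)
  have "words (n + k) J \<subseteq> (\<lambda>(u, w). u @ w) ` (words n J \<times> words k J)"
  proof
    fix u assume u: "u \<in> words (n + k) J"
    then have "(take n u, drop n u) \<in> words n J \<times> words k J"
      using set_take_subset[of n u] set_drop_subset[of n u] by (auto simp: words_def)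
    then show "u \<in> (\<lambda>(u, w). u @ w) ` (words n J \<times> words k J)"
      by (metis (no_types, lifting) append_take_drop_id case_prod_conv image_eqI)
  qed
  then have "words (n + k) J = (\<lambda>(u, w). u @ w) ` (words n J \<times> words k J)"
    by (auto simp: words_def)
  then show ?thesis
    using inj by (simp add: sum.reindex sum.cartesian_product case_prod_unfold)
qed

text \<open>Distributivity without commutativity: the \<open>k\<close> words chosen from the factors
  are concatenated into one word of length \<open>n * k\<close>, from which \<open>slice\<close>
  recovers them. This brings a product of sums into the form to which \<open>word_moment\<close>
  applies.\<close>

lemma prod_list_of_sums:
  fixes b :: "'i \<Rightarrow> 'a::cstar_algebra"
  assumes "\<And>j. length (es j) = n"
  shows "prod_list (map (\<lambda>j. \<Sum>w\<in>words n J. d j w *\<^sub>C prod_list (word_letters b w (es j))) [0..<k])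
    = (\<Sum>u\<in>words (n * k) J. (\<Prod>j<k. d j (slice n j u)) *\<^sub>C
        prod_list (word_letters b u (concat (map es [0..<k]))))"
proof (induction k)
  case 0
  have "words 0 J = {[]}"
    by (auto simp: words_def)
  then show ?case
    by (simp add: scaleC_one)
next
  case (Suc k)
  let ?P = "\<lambda>u. prod_list (word_letters b u (concat (map es [0..<k])))"
    and ?Q = "\<lambda>w. prod_list (word_letters b w (es k))"
  have len: "length (concat (map es [0..<k])) = n * k"
    by (induction k) (auto simp: assms)
  have "prod_list (map (\<lambda>j. \<Sum>w\<in>words n J. d j w *\<^sub>C prod_list (word_letters b w (es j))) [0..<Suc k])
      = (\<Sum>u\<in>words (n * k) J. (\<Prod>j<k. d j (slice n j u)) *\<^sub>C ?P u) *
        (\<Sum>w\<in>words n J. d k w *\<^sub>C ?Q w)"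
    using Suc by simp
  also have "\<dots> = (\<Sum>u\<in>words (n * k) J. \<Sum>w\<in>words n J.
      ((\<Prod>j<k. d j (slice n j u)) * d k w) *\<^sub>C (?P u * ?Q w))"
    by (simp add: sum_product mult_scaleC_left mult_scaleC_right scaleC_scaleC mult.commute[of "d k _"])
  also have "\<dots> = (\<Sum>u\<in>words (n * k) J. \<Sum>w\<in>words n J.
      (\<Prod>j<Suc k. d j (slice n j (u @ w))) *\<^sub>C
        prod_list (word_letters b (u @ w) (concat (map es [0..<Suc k]))))"
  proof (intro sum.cong refl)
    fix u w assume uw: "u \<in> words (n * k) J" "w \<in> words n J"
    then have l: "length u = n * k" "length w = n"
      by (auto simp: words_def)
    have "(\<Prod>j<k. d j (slice n j (u @ w))) = (\<Prod>j<k. d j (slice n j u))"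
      using l by (intro prod.cong) (auto simp: slice_append_left)
    then show "((\<Prod>j<k. d j (slice n j u)) * d k w) *\<^sub>C (?P u * ?Q w) =
      (\<Prod>j<Suc k. d j (slice n j (u @ w))) *\<^sub>C
        prod_list (word_letters b (u @ w) (concat (map es [0..<Suc k])))"
      using l by (simp add: len slice_append_right)
  qed
  also have "\<dots> = (\<Sum>u\<in>words (n * Suc k) J. (\<Prod>j<Suc k. d j (slice n j u)) *\<^sub>C
      prod_list (word_letters b u (concat (map es [0..<Suc k]))))"
    by (simp only: mult_Suc_right add.commute[of n] sum_words_append)
  finally show ?case .
qed

text \<open>With groups counted from 0, the odd ones are starred. This is the shape in which
  \<open>prod_list_of_sums\<close> produces the letters of an alternating product.\<close>

lemma pattern_eq_concat: "pattern n m = concat (map (\<lambda>j. replicate n (odd j)) [0..<2 * m])"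
proof (induction m)
  case (Suc m)
  have "pattern n (Suc m) = pattern n m @ replicate n False @ replicate n True"
    by (simp add: pattern_def replicate_append_same[symmetric] del: replicate_Suc)
      (simp add: replicate_append_same[symmetric])
  then show ?case
    using Suc by simp
qed (simp add: pattern_def)

lemma nth_concat_replicate:
  "p < n * k \<Longrightarrow> concat (map (\<lambda>j. replicate n (f j)) [0..<k]) ! p = f (p div n)"
proof (induction k)
  case (Suc k)
  have len: "length (concat (map (\<lambda>j. replicate n (f j)) [0..<k])) = n * k"
    by (induction k) auto
  show ?case
  proof (cases "p < n * k")
    case False
    then have "p div n = k"
      using Suc.prems by (intro div_nat_eqI) (auto simp: algebra_simps)
    then show ?thesis
      using False Suc.prems by (simp add: nth_append len)
  qed (use Suc in \<open>simp add: nth_append len\<close>)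
qed simp

lemma nth_pattern: "p < 2 * n * m \<Longrightarrow> pattern n m ! p = odd (p div n)"
  unfolding pattern_eq_concat by (rule nth_concat_replicate) (simp add: mult_ac)

section \<open>Homogeneous elements and their adjoints\<close>

text \<open>Taking all words over \<open>J\<close> gives different finite sums a common range of
  summation, with coefficients extended by zero.\<close>

definition homogeneous :: "('i \<Rightarrow> 'a::cstar_algebra) \<Rightarrow> nat \<Rightarrow> 'i set \<Rightarrow> ('i list \<Rightarrow> complex) \<Rightarrow> 'a" where
  "homogeneous b n J c = (\<Sum>w\<in>words n J. c w *\<^sub>C prod_list (map b w))"

text \<open>This is factor number \<open>j\<close> of an alternating product; the factors may come
  from different elements, which the Lipschitz estimate requires.\<close>

definition alt_star :: "nat \<Rightarrow> 'a::cstar_algebra \<Rightarrow> 'a" where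
  "alt_star j x = (if even j then x else star x)"

text \<open>The adjoint of a homogeneous element reverses its words; \<open>alt_coeff\<close> reindexes
  the coefficients so that words are always read from left to right.\<close>

definition alt_coeff :: "nat \<Rightarrow> ('i list \<Rightarrow> complex) \<Rightarrow> 'i list \<Rightarrow> complex" where
  "alt_coeff j c u = (if even j then c u else cnj (c (rev u)))"

lemma bij_betw_rev_words: "bij_betw rev (words n J) (words n J)"
  by (rule bij_betw_byWitness[where f' = rev]) (auto simp: words_def)

lemma L2_set_alt_coeff:
  "L2_set (\<lambda>w. cmod (alt_coeff j c w)) (words n J) = L2_set (\<lambda>w. cmod (c w)) (words n J)"
  using sum.reindex_bij_betw[OF bij_betw_rev_words, of "\<lambda>w. (cmod (c w))\<^sup>2"]
  by (cases "even j") (simp_all add: L2_set_def alt_coeff_def)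

lemma alt_star_homogeneous:
  "alt_star j (homogeneous b n J c) =
    (\<Sum>w\<in>words n J. alt_coeff j c w *\<^sub>C prod_list (word_letters b w (replicate n (odd j))))"
proof -
  have letters: "word_letters b w (replicate n False) = map b w"
      "word_letters b w (replicate n True) = map (\<lambda>i. star (b i)) w"
    if "w \<in> words n J" for w
    using that by (auto simp: words_def zip_replicate2 letter_def)
  show ?thesis
  proof (cases "even j")
    case True
    then show ?thesis
      unfolding alt_star_def homogeneous_def alt_coeff_def
      by (auto intro!: sum.cong simp: letters simp del: map_zip_map2)
  next
    case False
    have "star (homogeneous b n J c) = (\<Sum>w\<in>words n J. cnj (c w) *\<^sub>C prod_list (map (\<lambda>i. star (b i)) (rev w)))"
      by (simp add: homogeneous_def star_sum star_scaleC star_prod_list rev_map o_def)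
    also have "\<dots> = (\<Sum>w\<in>words n J. cnj (c (rev w)) *\<^sub>C prod_list (map (\<lambda>i. star (b i)) w))"
      by (subst sum.reindex_bij_betw[OF bij_betw_rev_words, symmetric]) simp
    finally show ?thesis
      using False unfolding alt_star_def alt_coeff_def
      by (auto intro!: sum.cong simp: letters simp del: map_zip_map2)
  qed
qed

text \<open>Positivity and faithfulness are postulated for \<open>star x * x\<close>, while the
  norms use \<open>x * star x\<close>; substituting \<open>star x\<close> passes from one to the
  other.\<close>

lemma faithful_stateD:
  assumes "faithful_state \<phi>"
  shows "\<phi> (x + y) = \<phi> x + \<phi> y" "\<phi> (c *\<^sub>C x) = c * \<phi> x"
    "\<phi> (x * star x) \<in> \<real>\<^sub>\<ge>\<^sub>0" "\<phi> (x * star x) = 0 \<Longrightarrow> x = 0"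
proof -
  have star_zero: "star (0 :: 'a) = 0"
    using star_sum[of "\<lambda>_. 0 :: 'a" "{}"] by simp
  show "\<phi> (x + y) = \<phi> x + \<phi> y" "\<phi> (c *\<^sub>C x) = c * \<phi> x"
    using assms by (auto simp: faithful_state_def)
  have "\<phi> (star (star x) * star x) \<in> \<real>\<^sub>\<ge>\<^sub>0"
    using assms by (auto simp: faithful_state_def)
  then show "\<phi> (x * star x) \<in> \<real>\<^sub>\<ge>\<^sub>0"
    by (simp add: star_star)
  have "\<phi> (star (star x) * star x) = 0 \<Longrightarrow> star x = 0"
    using assms by (auto simp: faithful_state_def)
  then show "\<phi> (x * star x) = 0 \<Longrightarrow> x = 0"
    by (metis star_star star_zero)
qed

lemma state_sum:
  assumes "faithful_state \<phi>"
  shows "\<phi> (\<Sum>i\<in>A. f i) = (\<Sum>i\<in>A. \<phi> (f i))"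
proof -
  interpret additive \<phi>
    by unfold_locales (rule faithful_stateD(1)[OF assms])
  show ?thesis
    by (rule sum)
qed

lemma state_diff:
  assumes "faithful_state \<phi>"
  shows "\<phi> (x - y) = \<phi> x - \<phi> y"
proof -
  interpret additive \<phi>
    by unfold_locales (rule faithful_stateD(1)[OF assms])
  show ?thesis
    by (rule diff)
qed

section \<open>Moments of alternating products and their bound\<close>

text \<open>Expand the product over words, apply \<open>word_moment\<close> to each word, and
  interchange the sums over words and partitions.\<close>

lemma alternating_moment:
  fixes \<psi> :: "'b::cstar_algebra \<Rightarrow> complex"
  assumes "R_diagonal \<phi> a" and "star_free \<psi> I b" and "faithful_state \<psi>"
    and "\<And>i. i \<in> I \<Longrightarrow> same_star_distribution \<psi> (b i) \<phi> a"
    and nm: "n \<ge> 1" "m \<ge> 1" and J: "finite J" "J \<subseteq> I"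
  shows "\<psi> (prod_list (map (\<lambda>j. alt_star j (homogeneous b n J (c j))) [0..<2 * m])) =
    (\<Sum>\<pi>\<in>NC_star n m. partition_cumulant \<phi> \<pi> (pattern_list a n m) *
      (\<Sum>u | u \<in> words (2 * n * m) J \<and> constant_on_blocks \<pi> u.
         \<Prod>j<2 * m. alt_coeff j (c j) (slice n j u)))"
proof -
  let ?K = "\<lambda>\<pi>. partition_cumulant \<phi> \<pi> (pattern_list a n m)"
    and ?C = "\<lambda>u. \<Prod>j<2 * m. alt_coeff j (c j) (slice n j u)"
  have N: "n * (2 * m) = 2 * n * m"
    by simp
  have "\<psi> (prod_list (map (\<lambda>j. alt_star j (homogeneous b n J (c j))) [0..<2 * m]))
      = (\<Sum>u\<in>words (2 * n * m) J. ?C u * \<psi> (prod_list (word_letters b u (pattern n m))))"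
    unfolding alt_star_homogeneous
    by (subst prod_list_of_sums)
      (simp_all only: length_replicate state_sum[OF assms(3)] faithful_stateD(2)[OF assms(3)] N
        pattern_eq_concat[symmetric])
  also have "\<dots> = (\<Sum>u\<in>words (2 * n * m) J. \<Sum>\<pi>\<in>NC_star n m.
      ?C u * (if constant_on_blocks \<pi> u then ?K \<pi> else 0))"
    unfolding sum_distrib_left[symmetric]
  proof (intro sum.cong refl arg_cong2[where f = "(*)"])
    fix u assume "u \<in> words (2 * n * m) J"
    then have "u \<in> words (2 * n * m) I"
      using J by (auto simp: words_def)
    then show "\<psi> (prod_list (word_letters b u (pattern n m))) =
        (\<Sum>\<pi>\<in>NC_star n m. if constant_on_blocks \<pi> u then ?K \<pi> else 0)"
      by (intro word_moment[OF assms(1,2,4)] nm)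
  qed
  also have "\<dots> = (\<Sum>\<pi>\<in>NC_star n m. \<Sum>u\<in>words (2 * n * m) J.
      if constant_on_blocks \<pi> u then ?K \<pi> * ?C u else 0)"
    by (subst sum.swap) (simp add: if_distrib mult.commute cong: if_cong)
  also have "\<dots> = (\<Sum>\<pi>\<in>NC_star n m. ?K \<pi> *
      (\<Sum>u | u \<in> words (2 * n * m) J \<and> constant_on_blocks \<pi> u. ?C u))"
    using finite_words[OF J(1), of "2 * n * m"]
    by (auto simp: sum.inter_filter sum_distrib_left intro!: sum.cong)
  finally show ?thesis .
qed

text \<open>A nonempty block of even size has at least two entries, and the first two differ.
  Letters of both kinds lie in different groups, which supplies the multiplicity 2 for Finner's
  inequality.\<close>

lemma NC_star_block_meets_both:
  assumes "\<pi> \<in> NC_star n m" "V \<in> \<pi>"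
  shows "\<exists>p\<in>V. \<exists>q\<in>V. p < 2 * n * m \<and> q < 2 * n * m \<and> \<not> pattern n m ! p \<and> pattern n m ! q"
proof -
  have \<pi>: "\<pi> \<in> NC (2 * n * m)" and ev: "even (card V)"
    and succ: "successively (\<noteq>) (nths (pattern n m) V)"
    using assms by (auto simp: NC_star_def)
  have V: "V \<subseteq> {..<2 * n * m}" "V \<noteq> {}"
    using NC_D[OF \<pi>] assms(2) by auto
  have "{i. i < 2 * n * m \<and> i \<in> V} = V"
    using V by auto
  then have "length (nths (pattern n m) V) = card V"
    by (simp add: length_nths length_pattern)
  moreover have "card V \<noteq> 0" "card V \<noteq> 1"
    using V ev finite_subset[OF V(1)] by auto
  ultimately obtain x y zs where *: "nths (pattern n m) V = x # y # zs"
    by (metis One_nat_def length_0_conv length_Cons list.exhaust)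
  then have "x \<noteq> y"
    using succ by simp
  then have "True \<in> set (nths (pattern n m) V)" "False \<in> set (nths (pattern n m) V)"
    using * by auto
  then show ?thesis
    unfolding set_nths by (auto simp: length_pattern)
qed

text \<open>A word constant on the blocks amounts to a labelling of the blocks by indices. Finner's
  inequality applies with the blocks as variables and the groups as factors, factor \<open>j\<close>
  depending only on the blocks that meet group \<open>j\<close>.\<close>

lemma sum_constant_on_blocks_le:
  fixes g :: "nat \<Rightarrow> 'i list \<Rightarrow> real"
  assumes \<pi>: "\<pi> \<in> NC_star n m" and J: "finite J" and g: "\<And>j w. g j w \<ge> 0"
  shows "(\<Sum>u | u \<in> words (2 * n * m) J \<and> constant_on_blocks \<pi> u. \<Prod>j<2 * m. g j (slice n j u))
    \<le> (\<Prod>j<2 * m. L2_set (g j) (words n J))"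
proof -
  have \<pi>': "\<pi> \<in> NC (2 * n * m)"
    using \<pi> by (auto simp: NC_star_def)
  note D = NC_D[OF \<pi>']
  have "\<exists>V. V \<in> \<pi> \<and> p \<in> V" if "p < 2 * n * m" for p
    using D(2) that by blast
  then obtain blk where blk: "\<And>p. p < 2 * n * m \<Longrightarrow> blk p \<in> \<pi> \<and> p \<in> blk p"
    by metis
  have blk_eq: "blk p = V" if "V \<in> \<pi>" "p \<in> V" for p V
  proof -
    have "p < 2 * n * m"
      using D(2) that by auto
    then show ?thesis
      using blk[of p] that D(3) by (auto simp: disjoint_def)
  qed
  have pos: "n * j + r < 2 * n * m" if "j < 2 * m" "r < n" for j r
  proof -
    have "n * j + n \<le> n * (2 * m)"
      using that mult_le_mono2[of "Suc j" "2 * m" n] by simp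
    then show ?thesis
      using that by simp
  qed
  \<comment> \<open>\<open>S j\<close> collects the blocks that meet group \<open>j\<close>,
    \<open>rd j\<close> reads the subword of that group off a labelling, and \<open>label\<close>
    turns a word into a labelling by sampling each block at its least position.\<close>
  define S where "S j = (\<lambda>r. blk (n * j + r)) ` {..<n}" for j
  define rd where "rd j i = map (\<lambda>r. i (blk (n * j + r))) [0..<n]" for j and i :: "nat set \<Rightarrow> 'i"
  define label where "label u = (\<lambda>V\<in>\<pi>. u ! Min V)" for u :: "'i list"
  let ?U = "{u \<in> words (2 * n * m) J. constant_on_blocks \<pi> u}"
  have Min: "Min V \<in> V" if "V \<in> \<pi>" for V
  proof -
    have "V \<subseteq> {..<2 * n * m}"
      using D(2) that by auto
    then show ?thesis
      using that D(4) finite_subset[of V "{..<2 * n * m}"] by (intro Min_in) auto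
  qed
  have label: "label u (blk p) = u ! p" if u: "u \<in> ?U" and p: "p < 2 * n * m" for u p
  proof -
    have "u ! Min (blk p) = u ! p"
      using u blk[OF p] Min[of "blk p"] by (auto simp: constant_on_blocks_def)
    then show ?thesis
      using blk[OF p] by (simp add: label_def)
  qed
  have slice: "slice n j u = rd j (restrict (label u) (S j))" if u: "u \<in> ?U" and j: "j < 2 * m" for u j
  proof (rule nth_equalityI)
    have len: "length u = n * (2 * m)"
      using u by (auto simp: words_def)
    then have le: "n * j \<le> length u"
      using j by simp
    then show l: "length (slice n j u) = length (rd j (restrict (label u) (S j)))"
      using length_slice[OF j len] by (simp add: rd_def)
    fix r assume "r < length (slice n j u)"
    then have r: "r < n"
      by (simp add: l rd_def)
    then show "slice n j u ! r = rd j (restrict (label u) (S j)) ! r"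
      using le label[OF u pos[OF j r]] by (simp add: slice_def rd_def S_def)
  qed
  have inj: "inj_on label ?U"
  proof (rule inj_onI)
    fix u u' assume u: "u \<in> ?U" "u' \<in> ?U" and eq: "label u = label u'"
    show "u = u'"
    proof (rule nth_equalityI)
      show "length u = length u'"
        using u by (auto simp: words_def)
      fix p assume "p < length u"
      then have "p < 2 * n * m"
        using u by (auto simp: words_def)
      then show "u ! p = u' ! p"
        using label[OF u(1)] label[OF u(2)] eq by metis
    qed
  qed
  have label_in: "label u \<in> PiE \<pi> (\<lambda>_. J)" if u: "u \<in> ?U" for u
  proof -
    have "u ! Min V \<in> J" if V: "V \<in> \<pi>" for V
    proof -
      have "Min V < length u"
        using Min[OF V] V D(2) u by (auto simp: words_def)
      then show ?thesis
        using u nth_mem by (auto simp: words_def)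
    qed
    then show ?thesis
      by (auto simp: label_def)
  qed
  have "(\<Sum>u\<in>?U. \<Prod>j<2 * m. g j (slice n j u))
      = (\<Sum>u\<in>?U. \<Prod>j<2 * m. g j (rd j (restrict (label u) (S j))))"
    by (intro sum.cong prod.cong refl) (simp add: slice)
  also have "\<dots> = (\<Sum>i\<in>label ` ?U. \<Prod>j<2 * m. g j (rd j (restrict i (S j))))"
    using inj by (simp add: sum.reindex)
  also have "\<dots> \<le> (\<Sum>i\<in>PiE \<pi> (\<lambda>_. J). \<Prod>j<2 * m. g j (rd j (restrict i (S j))))"
    using label_in D(1) J g by (intro sum_mono2 finite_PiE prod_nonneg) auto
  also have "\<dots> \<le> (\<Prod>j<2 * m. L2_set (\<lambda>i. g j (rd j i)) (PiE (S j) (\<lambda>_. J)))"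
  proof (rule Finner_inequality)
    show "S j \<subseteq> \<pi>" if "j \<in> {..<2 * m}" for j
      using that blk pos by (auto simp: S_def)
    show "card {j \<in> {..<2 * m}. V \<in> S j} \<ge> 2" if V: "V \<in> \<pi>" for V
    proof -
      obtain p q where pq: "p \<in> V" "q \<in> V" "p < 2 * n * m" "q < 2 * n * m"
        "\<not> pattern n m ! p" "pattern n m ! q"
        using NC_star_block_meets_both[OF \<pi> V] by blast
      \<comment> \<open>The group of a position is its quotient by \<open>n\<close>, and the parity
        of the group decides the star; different letters therefore lie in different groups.\<close>
      then have ne: "p div n \<noteq> q div n"
        using nth_pattern by metis
      have mem: "r div n \<in> {j \<in> {..<2 * m}. V \<in> S j}" if r: "r \<in> V" "r < 2 * n * m" for r
      proof -
        have "n > 0"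
          using r by (cases n) auto
        moreover have "V = blk (n * (r div n) + r mod n)"
          using blk_eq[OF V r(1)] by simp
        moreover have "r div n < 2 * m"
          using r by (intro less_mult_imp_div_less) (simp add: mult_ac)
        ultimately show ?thesis
          by (auto simp: S_def intro!: image_eqI[of _ _ "r mod n"])
      qed
      have "card {p div n, q div n} \<le> card {j \<in> {..<2 * m}. V \<in> S j}"
        using mem pq by (intro card_mono) auto
      then show ?thesis
        using ne by simp
    qed
  qed (use D(1) J g in auto)
  \<comment> \<open>A labelling of the blocks in \<open>S j\<close> is determined by the word it
    spells in group \<open>j\<close>, so the sum of squares over labellings is part of the sum over
    all words.\<close>
  also have "\<dots> \<le> (\<Prod>j<2 * m. L2_set (g j) (words n J))"
  proof (rule prod_mono)
    fix j assume j: "j \<in> {..<2 * m}"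
    have "inj_on (rd j) (PiE (S j) (\<lambda>_. J))"
    proof (rule inj_onI)
      fix i i' assume i: "i \<in> PiE (S j) (\<lambda>_. J)" "i' \<in> PiE (S j) (\<lambda>_. J)" "rd j i = rd j i'"
      show "i = i'"
        using i(1,2)
      proof (rule PiE_ext)
        fix V assume "V \<in> S j"
        then obtain r where "r < n" "V = blk (n * j + r)"
          by (auto simp: S_def)
        then show "i V = i' V"
          using i(3) by (auto simp: rd_def)
      qed
    qed
    then have "(\<Sum>i\<in>PiE (S j) (\<lambda>_. J). (g j (rd j i))\<^sup>2)
        = (\<Sum>w\<in>rd j ` PiE (S j) (\<lambda>_. J). (g j w)\<^sup>2)"
      by (simp add: sum.reindex)
    also have "\<dots> \<le> (\<Sum>w\<in>words n J. (g j w)\<^sup>2)"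
    proof (rule sum_mono2)
      have "i (blk (n * j + r)) \<in> J" if "i \<in> PiE (S j) (\<lambda>_. J)" "r < n" for i r
        using PiE_mem[OF that(1), of "blk (n * j + r)"] that(2) by (simp add: S_def)
      then show "rd j ` PiE (S j) (\<lambda>_. J) \<subseteq> words n J"
        by (auto simp: rd_def words_def)
    qed (use finite_words[OF J] in auto)
    finally show "0 \<le> L2_set (\<lambda>i. g j (rd j i)) (PiE (S j) (\<lambda>_. J)) \<and>
        L2_set (\<lambda>i. g j (rd j i)) (PiE (S j) (\<lambda>_. J)) \<le> L2_set (g j) (words n J)"
      by (simp add: L2_set_def sum_nonneg)
  qed
  finally show ?thesis .
qed

text \<open>The triangle inequality reduces this to one partition at a time. Passing to
  \<open>alt_coeff\<close> conjugates and reverses at most, which keeps the l2 norm.\<close>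

lemma alternating_moment_le:
  fixes \<psi> :: "'b::cstar_algebra \<Rightarrow> complex"
  assumes "R_diagonal \<phi> a" and "star_free \<psi> I b" and "faithful_state \<psi>"
    and "\<And>i. i \<in> I \<Longrightarrow> same_star_distribution \<psi> (b i) \<phi> a"
    and nm: "n \<ge> 1" "m \<ge> 1" and J: "finite J" "J \<subseteq> I"
  shows "cmod (\<psi> (prod_list (map (\<lambda>j. alt_star j (homogeneous b n J (c j))) [0..<2 * m])))
    \<le> (\<Sum>\<pi>\<in>NC_star n m. cmod (partition_cumulant \<phi> \<pi> (pattern_list a n m))) *
      (\<Prod>j<2 * m. L2_set (\<lambda>w. cmod (c j w)) (words n J))"
proof -
  have "cmod (\<Sum>u | u \<in> words (2 * n * m) J \<and> constant_on_blocks \<pi> u.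
         \<Prod>j<2 * m. alt_coeff j (c j) (slice n j u))
      \<le> (\<Prod>j<2 * m. L2_set (\<lambda>w. cmod (c j w)) (words n J))" if \<pi>: "\<pi> \<in> NC_star n m" for \<pi>
  proof -
    have "cmod (\<Sum>u | u \<in> words (2 * n * m) J \<and> constant_on_blocks \<pi> u.
         \<Prod>j<2 * m. alt_coeff j (c j) (slice n j u))
      \<le> (\<Sum>u | u \<in> words (2 * n * m) J \<and> constant_on_blocks \<pi> u.
         \<Prod>j<2 * m. cmod (alt_coeff j (c j) (slice n j u)))"
      unfolding prod_norm by (rule norm_sum)
    also have "\<dots> \<le> (\<Prod>j<2 * m. L2_set (\<lambda>w. cmod (alt_coeff j (c j) w)) (words n J))"
      by (rule sum_constant_on_blocks_le[OF \<pi> J(1)]) simp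
    finally show ?thesis
      by (simp only: L2_set_alt_coeff)
  qed
  moreover have "\<psi> (prod_list (map (\<lambda>j. alt_star j (homogeneous b n J (c j))) [0..<2 * m])) =
    (\<Sum>\<pi>\<in>NC_star n m. partition_cumulant \<phi> \<pi> (pattern_list a n m) *
      (\<Sum>u | u \<in> words (2 * n * m) J \<and> constant_on_blocks \<pi> u.
         \<Prod>j<2 * m. alt_coeff j (c j) (slice n j u)))"
    by (rule alternating_moment[OF assms(1-3) _ nm J]) (rule assms(4))
  ultimately show ?thesis
    unfolding sum_distrib_right by (auto intro!: sum_norm_le simp: norm_mult mult_left_mono)
qed

section \<open>The case \<open>m = 1\<close>\<close>

text \<open>The fully nested pairing; the \<open>- 1\<close> in the mirror image comes from
  numbering positions from 0.\<close>

definition rainbow :: "nat \<Rightarrow> nat set set" where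
  "rainbow n = (\<lambda>p. {p, 2 * n - 1 - p}) ` {..<n}"

text \<open>For \<open>m = 1\<close> the pattern is an unstarred half followed by a starred half, so
  the letters along a block come out sorted.\<close>

lemma nths_pattern_1_block:
  assumes "V \<subseteq> {..<2 * n}"
  shows "nths (pattern n 1) V =
    replicate (card (V \<inter> {..<n})) False @ replicate (card (V \<inter> {n..})) True"
proof -
  have rep: "nths (replicate k e) W = replicate (card (W \<inter> {..<k})) e" for k W and e :: bool
  proof -
    have "nths (replicate k e) W = replicate (length (nths (replicate k e) W)) e"
      by (subst replicate_length_same) (auto dest: in_set_nthsD)
    then show ?thesis
      by (simp add: length_nths Int_def conj_commute)
  qed
  have "V \<inter> {n..} = (\<lambda>j. j + n) ` ({j. j + n \<in> V} \<inter> {..<n})"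
  proof (intro equalityI subsetI)
    fix q assume "q \<in> V \<inter> {n..}"
    then show "q \<in> (\<lambda>j. j + n) ` ({j. j + n \<in> V} \<inter> {..<n})"
      using assms by (intro image_eqI[of _ _ "q - n"]) auto
  qed auto
  then have "card ({j. j + n \<in> V} \<inter> {..<n}) = card (V \<inter> {n..})"
    by (simp add: card_image)
  then show ?thesis
    by (simp add: pattern_def nths_append rep)
qed

text \<open>A sorted list alternates only if each letter occurs at most once; even size and
  nonemptiness then leave exactly one position in each half.\<close>

lemma NC_star_1_block:
  assumes "V \<subseteq> {..<2 * n}" "V \<noteq> {}"
  shows "even (card V) \<and> successively (\<noteq>) (nths (pattern n 1) V) \<longleftrightarrow>
    (\<exists>p<n. \<exists>q\<in>{n..<2 * n}. V = {p, q})"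
proof -
  let ?A = "V \<inter> {..<n}" and ?B = "V \<inter> {n..}"
  have fin: "finite V"
    using assms(1) finite_subset by blast
  have V: "V = ?A \<union> ?B"
    by auto
  have card: "card V = card ?A + card ?B"
    using fin by (subst V, subst card_Un_disjoint) auto
  have succ: "successively (\<noteq>) (replicate k False @ replicate l True) \<longleftrightarrow> k \<le> 1 \<and> l \<le> 1" for k l
  proof -
    have "successively (\<noteq>) (replicate k e) \<longleftrightarrow> k \<le> 1" for k and e :: bool
      by (cases k; cases "k - 1") auto
    then show ?thesis
      by (auto simp: successively_append_iff)
  qed
  show ?thesis
    unfolding nths_pattern_1_block[OF assms(1)] succ
  proof
    assume *: "even (card V) \<and> card ?A \<le> 1 \<and> card ?B \<le> 1"
    have "card V \<noteq> 0"
      using assms fin by auto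
    then have "card ?A = 1" "card ?B = 1"
      using * card by (auto simp: le_Suc_eq)
    then obtain p q where "?A = {p}" "?B = {q}"
      by (metis card_1_singletonE)
    then show "\<exists>p<n. \<exists>q\<in>{n..<2 * n}. V = {p, q}"
      using V assms(1) by (intro exI[of _ p] conjI bexI[of _ q]) auto
  next
    assume "\<exists>p<n. \<exists>q\<in>{n..<2 * n}. V = {p, q}"
    then obtain p q where pq: "p < n" "n \<le> q" "V = {p, q}"
      by auto
    then have "?A = {p}" "?B = {q}"
      by auto
    then show "even (card V) \<and> card ?A \<le> 1 \<and> card ?B \<le> 1"
      using card by simp
  qed
qed

lemma rainbow_in_NC_star: "rainbow n \<in> NC_star n 1"
proof -
  have "partition_on {..<2 * n} (rainbow n)"
  proof (rule partition_onI)
    show "\<Union> (rainbow n) = {..<2 * n}"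
    proof (intro equalityI subsetI)
      fix q assume q: "q \<in> {..<2 * n}"
      show "q \<in> \<Union> (rainbow n)"
      proof (cases "q < n")
        case False
        then have "2 * n - 1 - q < n" "q = 2 * n - 1 - (2 * n - 1 - q)"
          using q by auto
        then show ?thesis
          by (auto simp: rainbow_def)
      qed (auto simp: rainbow_def)
    qed (auto simp: rainbow_def)
  qed (auto simp: rainbow_def disjnt_def)
  moreover have "V = W" if "V \<in> rainbow n" "W \<in> rainbow n" "i \<in> V" "j \<in> W" "k \<in> V" "l \<in> W"
    "i < j" "j < k" "k < l" for V W i j k l
    using that by (auto simp: rainbow_def)
  ultimately have NC: "rainbow n \<in> NC (2 * n)"
    unfolding NC_def by blast
  have "even (card V) \<and> successively (\<noteq>) (nths (pattern n 1) V)" if V: "V \<in> rainbow n" for V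
  proof (subst NC_star_1_block)
    show "V \<subseteq> {..<2 * n}" "V \<noteq> {}"
      using V by (auto simp: rainbow_def)
    show "\<exists>p<n. \<exists>q\<in>{n..<2 * n}. V = {p, q}"
      using V by (fastforce simp: rainbow_def)
  qed
  then show ?thesis
    using NC by (simp add: NC_star_def)
qed

text \<open>If \<open>\<sigma> p\<close> is the partner of \<open>p < n\<close>, then \<open>\<sigma>\<close> is strictly decreasing because there
  are no crossings, so \<open>\<sigma> p + p\<close> is decreasing; its values at \<open>0\<close> and \<open>n - 1\<close> force it to
  be constant.\<close>

lemma NC_star_1: "NC_star n 1 = {rainbow n}"
proof -
  have "\<pi> = rainbow n" if "\<pi> \<in> NC_star n 1" for \<pi>
  proof -
    have \<pi>: "\<pi> \<in> NC (2 * n)"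
      using that by (simp add: NC_star_def)
    note D = NC_D[OF \<pi>]
    have noncrossing: "V = W"
      if "V \<in> \<pi>" "W \<in> \<pi>" "i \<in> V" "j \<in> W" "k \<in> V" "l \<in> W" "i < j" "j < k" "k < l" for V W i j k l
      using \<pi> that unfolding NC_def by blast
    have block: "\<exists>p<n. \<exists>q\<in>{n..<2 * n}. V = {p, q}" if V: "V \<in> \<pi>" for V
    proof (subst NC_star_1_block[symmetric])
      show "V \<subseteq> {..<2 * n}" "V \<noteq> {}"
        using D V by auto
      show "even (card V) \<and> successively (\<noteq>) (nths (pattern n 1) V)"
        using \<open>\<pi> \<in> NC_star n 1\<close> V by (simp add: NC_star_def)
    qed
    have "\<exists>q. q \<in> {n..<2 * n} \<and> {p, q} \<in> \<pi>" if p: "p < n" for p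
    proof -
      have "p \<in> \<Union>\<pi>"
        using p D(2) by auto
      then obtain V where V: "V \<in> \<pi>" "p \<in> V"
        by auto
      then obtain p' q where pq: "p' < n" "q \<in> {n..<2 * n}" "V = {p', q}"
        using block by blast
      then have "p' = p"
        using p V by auto
      then show ?thesis
        using V pq by blast
    qed
    then obtain \<sigma> where \<sigma>: "\<And>p. p < n \<Longrightarrow> n \<le> \<sigma> p \<and> \<sigma> p < 2 * n \<and> {p, \<sigma> p} \<in> \<pi>"
      by (metis atLeastLessThan_iff)
    have anti: "\<sigma> p' < \<sigma> p" if "p < p'" "p' < n" for p p'
    proof (rule ccontr)
      assume "\<not> \<sigma> p' < \<sigma> p"
      have p: "p < n"
        using that by simp
      have "p \<notin> {p', \<sigma> p'}"
        using that \<sigma>[OF that(2)] by auto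
      then have ne: "{p, \<sigma> p} \<noteq> {p', \<sigma> p'}"
        by blast
      then have "{p, \<sigma> p} \<inter> {p', \<sigma> p'} = {}"
        using disjointD[OF D(3)] \<sigma>[OF p] \<sigma>[OF that(2)] by metis
      then have "\<sigma> p < \<sigma> p'"
        using \<open>\<not> \<sigma> p' < \<sigma> p\<close> by auto
      moreover have "p' < \<sigma> p"
        using \<sigma>[OF p] that by simp
      \<comment> \<open>Otherwise \<open>p\<close>, \<open>p'\<close>, \<open>\<sigma> p\<close>,
        \<open>\<sigma> p'\<close>, in this increasing order, would form a crossing.\<close>
      ultimately have "{p, \<sigma> p} = {p', \<sigma> p'}"
        using noncrossing[of "{p, \<sigma> p}" "{p', \<sigma> p'}" p p' "\<sigma> p" "\<sigma> p'"]
          \<sigma>[OF p] \<sigma>[OF that(2)] that(1) by simp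
      then show False
        using ne by simp
    qed
    have "\<sigma> p + p \<le> 2 * n - 1" if "p < n" for p
      using that
    proof (induction p)
      case 0
      then show ?case
        using \<sigma>[of 0] by auto
    next
      case (Suc p)
      then show ?case
        using anti[of p "Suc p"] by simp
    qed
    moreover have "\<sigma> p + p \<ge> 2 * n - 1" if "p < n" for p
      using that
    proof (induction "n - 1 - p" arbitrary: p)
      case 0
      then show ?case
        using \<sigma>[of p] by auto
    next
      case (Suc k)
      then have "k = n - 1 - Suc p" "Suc p < n"
        by auto
      then have "\<sigma> (Suc p) + Suc p \<ge> 2 * n - 1"
        by (rule Suc.hyps(1))
      then show ?case
        using anti[of p "Suc p"] \<open>Suc p < n\<close> by simp
    qed
    ultimately have \<sigma>_eq: "\<sigma> p = 2 * n - 1 - p" if "p < n" for p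
      using that by (metis add_diff_cancel_right' le_antisym)
    show "\<pi> = rainbow n"
    proof (intro equalityI subsetI)
      fix V assume V: "V \<in> \<pi>"
      then obtain p q where pq: "p < n" "q \<in> {n..<2 * n}" "V = {p, q}"
        using block by blast
      have "V \<inter> {p, \<sigma> p} \<noteq> {}"
        using pq by auto
      then have "V = {p, \<sigma> p}"
        using disjointD[OF D(3) V] \<sigma>[OF pq(1)] by blast
      then show "V \<in> rainbow n"
        using \<sigma>_eq pq(1) by (auto simp: rainbow_def)
    next
      fix V assume "V \<in> rainbow n"
      then show "V \<in> \<pi>"
        using \<sigma> \<sigma>_eq by (auto simp: rainbow_def)
    qed
  qed
  then show ?thesis
    using rainbow_in_NC_star by auto
qed

text \<open>The mirror image of position \<open>p\<close> falls on position \<open>n - 1 - p\<close>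
  of the second word, so equality along the pairs says that one word is the reverse of the
  other.\<close>

lemma constant_on_rainbow:
  assumes "w \<in> words n J" "v \<in> words n J"
  shows "constant_on_blocks (rainbow n) (w @ v) \<longleftrightarrow> v = rev w"
proof -
  have len: "length w = n" "length v = n"
    using assms by (auto simp: words_def)
  have eq: "(w @ v) ! (2 * n - 1 - p) = v ! (n - 1 - p)" if "p < n" for p
  proof -
    have "2 * n - 1 - p = n + (n - 1 - p)"
      using that by simp
    then show ?thesis
      using len by (metis nth_append_length_plus)
  qed
  have "constant_on_blocks (rainbow n) (w @ v) \<longleftrightarrow> (\<forall>p<n. (w @ v) ! p = (w @ v) ! (2 * n - 1 - p))"
    unfolding constant_on_blocks_def rainbow_def by auto
  also have "\<dots> \<longleftrightarrow> (\<forall>p<n. w ! p = v ! (n - 1 - p))"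
    using eq len by (simp add: nth_append)
  also have "\<dots> \<longleftrightarrow> w = rev v"
    using len by (auto simp: list_eq_iff_nth_eq rev_nth)
  finally show ?thesis
    by auto
qed

lemma partition_cumulant_rainbow:
  "partition_cumulant \<phi> (rainbow n) (pattern_list a n 1) = free_cumulant \<phi> [a, star a] ^ n"
proof -
  have "nths (pattern_list a n 1) V = [a, star a]" if V: "V \<in> rainbow n" for V
  proof -
    obtain p where p: "p < n" "V = {p, 2 * n - 1 - p}"
      using V by (auto simp: rainbow_def)
    then have "V \<subseteq> {..<2 * n}" "V \<inter> {..<n} = {p}" "V \<inter> {n..} = {2 * n - 1 - p}"
      by auto
    then have "nths (pattern n 1) V = [False, True]"
      unfolding nths_pattern_1_block[OF \<open>V \<subseteq> {..<2 * n}\<close>] by simp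
    then show ?thesis
      by (simp add: pattern_list_def nths_map letter_def)
  qed
  moreover have "card (rainbow n) = n"
    unfolding rainbow_def by (subst card_image) (auto simp: inj_on_def doubleton_eq_iff)
  ultimately show ?thesis
    by (simp add: partition_cumulant_def)
qed

text \<open>This is \<open>word_moment\<close> for a family with the single index \<open>()\<close>,
  where freeness is vacuous; the only partition in \<open>NC_star 1 1\<close> is the one
  pair.\<close>

lemma free_cumulant_a_star_a:
  assumes "R_diagonal \<phi> a"
  shows "free_cumulant \<phi> [a, star a] = \<phi> (a * star a)"
proof -
  have "\<phi> (prod_list (word_letters (\<lambda>_. a) [(), ()] (pattern 1 1))) =
    (\<Sum>\<pi>\<in>NC_star 1 1. if constant_on_blocks \<pi> [(), ()]
       then partition_cumulant \<phi> \<pi> (pattern_list a 1 1) else 0)"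
    by (rule word_moment[OF assms, of _ UNIV])
      (auto simp: star_free_def same_star_distribution_def words_def)
  then show ?thesis
    using partition_cumulant_rainbow[of \<phi> 1 a] unfolding NC_star_1
    by (simp add: pattern_def letter_def constant_on_blocks_def)
qed

section \<open>The 2-norm of a homogeneous element\<close>

text \<open>In the case \<open>m = 1\<close> of \<open>alternating_moment\<close> the rainbow forces
  the second word to be the reverse of the first. The adjoint reverses it back, so the double sum
  collapses to the squared moduli of the coefficients.\<close>

lemma second_moment:
  fixes \<psi> :: "'b::cstar_algebra \<Rightarrow> complex"
  assumes "R_diagonal \<phi> a" and "star_free \<psi> I b" and "faithful_state \<psi>"
    and "\<And>i. i \<in> I \<Longrightarrow> same_star_distribution \<psi> (b i) \<phi> a"
    and n: "n \<ge> 1" and J: "finite J" "J \<subseteq> I"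
  shows "\<psi> (homogeneous b n J c * star (homogeneous b n J c)) =
    \<phi> (a * star a) ^ n * of_real ((L2_set (\<lambda>w. cmod (c w)) (words n J))\<^sup>2)"
proof -
  let ?x = "homogeneous b n J c"
  let ?F = "\<lambda>u. c (slice n 0 u) * cnj (c (rev (slice n 1 u)))"
  have fin: "finite (words n J)"
    by (rule finite_words[OF J(1)])
  have "(\<Sum>u | u \<in> words (2 * n * 1) J \<and> constant_on_blocks (rainbow n) u. ?F u)
      = (\<Sum>u\<in>words (n + n) J. if constant_on_blocks (rainbow n) u then ?F u else 0)"
    using finite_words[OF J(1)] by (simp add: sum.inter_filter mult_2 cong: if_cong)
  also have "\<dots> = (\<Sum>w\<in>words n J. \<Sum>v\<in>words n J. if v = rev w then ?F (w @ v) else 0)"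
    unfolding sum_words_append by (intro sum.cong refl) (simp add: constant_on_rainbow)
  also have "\<dots> = (\<Sum>w\<in>words n J. c w * cnj (c w))"
  proof (rule sum.cong[OF refl])
    fix w assume w: "w \<in> words n J"
    then have "rev w \<in> words n J" and len: "length w = n"
      by (auto simp: words_def)
    then show "(\<Sum>v\<in>words n J. if v = rev w then ?F (w @ v) else 0) = c w * cnj (c w)"
      using fin by (simp add: sum.delta slice_def)
  qed
  also have "\<dots> = of_real ((L2_set (\<lambda>w. cmod (c w)) (words n J))\<^sup>2)"
    by (simp add: L2_set_def sum_nonneg complex_norm_square[symmetric])
  finally have sum: "(\<Sum>u | u \<in> words (2 * n * 1) J \<and> constant_on_blocks (rainbow n) u. ?F u)
      = of_real ((L2_set (\<lambda>w. cmod (c w)) (words n J))\<^sup>2)" .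
  have "\<psi> (prod_list (map (\<lambda>j. alt_star j (homogeneous b n J ((\<lambda>_. c) j))) [0..<2 * 1])) =
    (\<Sum>\<pi>\<in>NC_star n 1. partition_cumulant \<phi> \<pi> (pattern_list a n 1) *
      (\<Sum>u | u \<in> words (2 * n * 1) J \<and> constant_on_blocks \<pi> u.
         \<Prod>j<2 * 1. alt_coeff j ((\<lambda>_. c) j) (slice n j u)))"
    by (rule alternating_moment[OF assms(1-3) _ n _ J]) (simp_all add: assms(4))
  moreover have "[0..<2 * 1] = [0, 1]" "{..<2 * 1} = {0, 1 :: nat}"
    by (auto simp: upt_rec)
  ultimately show ?thesis
    using sum unfolding NC_star_1
    by (simp add: alt_star_def alt_coeff_def partition_cumulant_rainbow[unfolded One_nat_def]
        free_cumulant_a_star_a[OF assms(1)])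
qed

lemma norm2_square:
  assumes "faithful_state \<phi>"
  shows "\<phi> (x * star x) = of_real ((norm2 \<phi> x)\<^sup>2)"
proof -
  obtain r where r: "\<phi> (x * star x) = of_real r" "r \<ge> 0"
    using faithful_stateD(3)[OF assms, of x] by (auto elim!: nonneg_Reals_cases)
  then have "norm2 \<phi> x = sqrt r"
    by (simp add: even_norm_def sqrt_def)
  then show ?thesis
    using r by (simp only: real_sqrt_pow2)
qed

lemma norm2_nonneg: "faithful_state \<phi> \<Longrightarrow> norm2 \<phi> x \<ge> 0"
  using faithful_stateD(3)[of \<phi> x]
  by (auto simp: even_norm_def elim!: nonneg_Reals_cases)

lemma norm2_pos:
  assumes "faithful_state \<phi>" "x \<noteq> 0"
  shows "norm2 \<phi> x > 0"
  using faithful_stateD(4)[OF assms(1), of x] norm2_square[OF assms(1), of x]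
    norm2_nonneg[OF assms(1), of x] assms(2)
  by (cases "norm2 \<phi> x = 0") auto

text \<open>Square roots in \<open>second_moment\<close>; this trades the l2 norms produced by
  Finner's inequality for 2-norms.\<close>

lemma norm2_homogeneous:
  fixes \<psi> :: "'b::cstar_algebra \<Rightarrow> complex"
  assumes "faithful_state \<phi>"
    and "R_diagonal \<phi> a" and "star_free \<psi> I b" and "faithful_state \<psi>"
    and "\<And>i. i \<in> I \<Longrightarrow> same_star_distribution \<psi> (b i) \<phi> a"
    and n: "n \<ge> 1" and J: "finite J" "J \<subseteq> I"
  shows "norm2 \<psi> (homogeneous b n J c) = norm2 \<phi> a ^ n * L2_set (\<lambda>w. cmod (c w)) (words n J)"
proof (rule power2_eq_imp_eq)
  have "complex_of_real ((norm2 \<psi> (homogeneous b n J c))\<^sup>2)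
      = of_real ((norm2 \<phi> a)\<^sup>2) ^ n * of_real ((L2_set (\<lambda>w. cmod (c w)) (words n J))\<^sup>2)"
    unfolding norm2_square[OF assms(1), symmetric] norm2_square[OF assms(4), symmetric]
    by (rule second_moment[OF assms(2-4) _ n J]) (rule assms(5))
  also have "\<dots> = of_real ((norm2 \<phi> a ^ n * L2_set (\<lambda>w. cmod (c w)) (words n J))\<^sup>2)"
    by (simp add: power_mult_distrib power_mult[symmetric] mult.commute)
  finally show "(norm2 \<psi> (homogeneous b n J c))\<^sup>2
      = (norm2 \<phi> a ^ n * L2_set (\<lambda>w. cmod (c w)) (words n J))\<^sup>2"
    by (simp only: of_real_eq_iff)
qed (use norm2_nonneg assms(1,4) in \<open>auto intro!: mult_nonneg_nonneg zero_le_power\<close>)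

section \<open>Finite sums and their limits\<close>

lemma sum_words_eq_homogeneous:
  fixes b :: "'i \<Rightarrow> 'a::cstar_algebra"
  assumes "W \<subseteq> words n J" "finite J"
  shows "(\<Sum>w\<in>W. c w *\<^sub>C prod_list (map b w))
    = homogeneous b n J (\<lambda>w. if w \<in> W then c w else 0)"
proof -
  have "0 *\<^sub>C x = 0" for x :: 'a
    using scaleR_scaleC[of 0 x] by simp
  then show ?thesis
    unfolding homogeneous_def using assms
    by (intro sum.mono_neutral_cong_left finite_words) auto
qed

text \<open>The indices occurring in finitely many finite sums form one finite set, over which all
  of these sums can be written at once.\<close>

lemma finite_sums_homogeneous:
  assumes "\<And>j. j \<in> A \<Longrightarrow> X j \<in> finite_sums n I b" "finite A"
  shows "\<exists>J c. finite J \<and> J \<subseteq> I \<and> (\<forall>j\<in>A. X j = homogeneous b n J (c j))"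
proof -
  have "\<exists>W c. finite W \<and> W \<subseteq> words n I \<and> X j = (\<Sum>w\<in>W. c w *\<^sub>C prod_list (map b w))"
    if "j \<in> A" for j
    using assms(1)[OF that] unfolding finite_sums_def words_def by blast
  then obtain W c where W: "\<And>j. j \<in> A \<Longrightarrow> finite (W j) \<and> W j \<subseteq> words n I \<and>
      X j = (\<Sum>w\<in>W j. c j w *\<^sub>C prod_list (map b w))"
    by metis
  define J where "J = (\<Union>j\<in>A. \<Union>w\<in>W j. set w)"
  have "set w \<subseteq> I" if "j \<in> A" "w \<in> W j" for j w
    using W[OF that(1)] that(2) by (auto simp: words_def)
  then have J: "finite J" "J \<subseteq> I"
    using W assms(2) by (auto simp: J_def)
  have "W j \<subseteq> words n J" if "j \<in> A" for j
    using W[OF that] that by (auto simp: J_def words_def)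
  then have "X j = homogeneous b n J (\<lambda>w. if w \<in> W j then c j w else 0)" if "j \<in> A" for j
    using that W J(1) sum_words_eq_homogeneous[of "W j" n J "c j" b] by simp
  then show ?thesis
    using J by (intro exI[of _ J] exI[of _ "\<lambda>j w. if w \<in> W j then c j w else 0"]) simp
qed

lemma finite_sums_diff:
  fixes b :: "'i \<Rightarrow> 'b::cstar_algebra"
  assumes "x \<in> finite_sums n I b" "y \<in> finite_sums n I b"
  shows "x - y \<in> finite_sums n I b"
proof -
  \<comment> \<open>The two elements are treated as a family indexed by the Booleans to obtain a
    common \<open>J\<close>.\<close>
  have "\<exists>J c. finite J \<and> J \<subseteq> I \<and> (\<forall>j\<in>UNIV. (if j then x else y) = homogeneous b n J (c j))"
    using assms by (intro finite_sums_homogeneous) auto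
  then obtain J c where J: "finite J" "J \<subseteq> I"
    and c: "\<And>j. (if j then x else y) = homogeneous b n J (c j)"
    by blast
  have diff: "(c - d) *\<^sub>C z = c *\<^sub>C z - d *\<^sub>C z" for c d :: complex and z :: 'b
    using scaleC_add_left[of "c - d" d z] by simp
  have "x - y = (\<Sum>w\<in>words n J. (c True w - c False w) *\<^sub>C prod_list (map b w))"
    using c[of True] c[of False] by (simp add: homogeneous_def diff sum_subtractf)
  moreover have "finite (words n J)" "words n J \<subseteq> {w. length w = n \<and> set w \<subseteq> I}"
    using finite_words[OF J(1)] J(2) by (auto simp: words_def)
  ultimately show ?thesis
    unfolding finite_sums_def
    by (intro CollectI exI[of _ "words n J"] exI[of _ "\<lambda>w. c True w - c False w"] conjI)
qed

text \<open>The coefficient-free form of \<open>alternating_moment_le\<close>: over a common index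
  set each l2 norm is a 2-norm divided by \<open>norm2 \<phi> a ^ n\<close>, which is positive
  because \<open>a \<noteq> 0\<close>.\<close>

lemma alternating_moment_finite_sums_le:
  fixes \<psi> :: "'b::cstar_algebra \<Rightarrow> complex"
  assumes "faithful_state \<phi>" "a \<noteq> 0"
    and "R_diagonal \<phi> a" and "star_free \<psi> I b" and "faithful_state \<psi>"
    and dist: "\<And>i. i \<in> I \<Longrightarrow> same_star_distribution \<psi> (b i) \<phi> a"
    and nm: "n \<ge> 1" "m \<ge> 1"
    and X: "\<And>j. j < 2 * m \<Longrightarrow> X j \<in> finite_sums n I b"
  shows "cmod (\<psi> (prod_list (map (\<lambda>j. alt_star j (X j)) [0..<2 * m])))
    \<le> (\<Sum>\<pi>\<in>NC_star n m. cmod (partition_cumulant \<phi> \<pi> (pattern_list a n m))) *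
      (\<Prod>j<2 * m. norm2 \<psi> (X j) / norm2 \<phi> a ^ n)"
proof -
  have "\<exists>J c. finite J \<and> J \<subseteq> I \<and> (\<forall>j\<in>{..<2 * m}. X j = homogeneous b n J (c j))"
    using X by (intro finite_sums_homogeneous) auto
  then obtain J c where J: "finite J" "J \<subseteq> I"
    and c: "\<And>j. j < 2 * m \<Longrightarrow> X j = homogeneous b n J (c j)"
    by auto
  have "map (\<lambda>j. alt_star j (X j)) [0..<2 * m]
      = map (\<lambda>j. alt_star j (homogeneous b n J (c j))) [0..<2 * m]"
    using c by simp
  moreover have "(\<Prod>j<2 * m. norm2 \<psi> (X j) / norm2 \<phi> a ^ n)
      = (\<Prod>j<2 * m. L2_set (\<lambda>w. cmod (c j w)) (words n J))"
  proof (rule prod.cong[OF refl])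
    fix j assume "j \<in> {..<2 * m}"
    then have "norm2 \<psi> (X j) = norm2 \<phi> a ^ n * L2_set (\<lambda>w. cmod (c j w)) (words n J)"
      using c norm2_homogeneous[OF assms(1,3-5) dist nm(1) J] by simp
    then show "norm2 \<psi> (X j) / norm2 \<phi> a ^ n = L2_set (\<lambda>w. cmod (c j w)) (words n J)"
      using norm2_pos[OF assms(1,2)] by simp
  qed
  moreover have "cmod (\<psi> (prod_list (map (\<lambda>j. alt_star j (homogeneous b n J (c j))) [0..<2 * m])))
    \<le> (\<Sum>\<pi>\<in>NC_star n m. cmod (partition_cumulant \<phi> \<pi> (pattern_list a n m))) *
      (\<Prod>j<2 * m. L2_set (\<lambda>w. cmod (c j w)) (words n J))"
    by (rule alternating_moment_le[OF assms(3-5) _ nm J]) (rule dist)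
  ultimately show ?thesis
    by (simp only:)
qed

section \<open>Continuity and bound for the even moments\<close>

lemma prod_list_alt_star: "prod_list (map (\<lambda>j. alt_star j x) [0..<2 * m]) = (x * star x) ^ m"
proof (induction m)
  case (Suc m)
  have "[0..<2 * Suc m] = [0..<2 * m] @ [2 * m, Suc (2 * m)]"
    by simp
  then have "prod_list (map (\<lambda>j. alt_star j x) [0..<2 * Suc m])
      = (x * star x) ^ m * (alt_star (2 * m) x * alt_star (Suc (2 * m)) x)"
    using Suc by (simp only: map_append prod_list.append) simp
  then show ?case
    by (simp add: alt_star_def power_Suc2 del: power_Suc)
qed simp

text \<open>Telescoping: the factors \<open>f j\<close> are exchanged for \<open>g j\<close> one at
  a time from the left, without changing the order of multiplication.\<close>

lemma prod_list_diff:
  fixes f g :: "nat \<Rightarrow> 'a::ring_1"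
  shows "prod_list (map f [0..<k]) - prod_list (map g [0..<k]) =
    (\<Sum>i<k. prod_list (map (\<lambda>j. if j < i then g j else if j = i then f j - g j else f j) [0..<k]))"
proof (induction k)
  case (Suc k)
  let ?h = "\<lambda>i j. if j < i then g j else if j = i then f j - g j else f j"
  have "map (?h k) [0..<k] = map g [0..<k]"
    by simp
  then have "(\<Sum>i<Suc k. prod_list (map (?h i) [0..<Suc k]))
      = (\<Sum>i<k. prod_list (map (?h i) [0..<k])) * f k + prod_list (map g [0..<k]) * (f k - g k)"
    by (simp add: sum_distrib_right del: map_eq_conv)
  then show ?case
    by (simp add: Suc[symmetric] algebra_simps)
qed simp

lemma alt_star_diff: "alt_star j (x - y) = alt_star j x - alt_star j y"
proof -
  interpret additive "star :: 'a \<Rightarrow> 'a"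
    by unfold_locales (rule star_add)
  show ?thesis
    by (simp add: alt_star_def diff)
qed

text \<open>The triangle inequality for \<open>even_norm\<close> is not available, because the state need not be
  tracial. The multilinear bound on alternating moments gives continuity of the moment instead.\<close>

lemma even_moment_Lipschitz:
  fixes \<psi> :: "'b::cstar_algebra \<Rightarrow> complex"
  assumes "faithful_state \<phi>" "a \<noteq> 0"
    and "R_diagonal \<phi> a" and "star_free \<psi> I b" and "faithful_state \<psi>"
    and dist: "\<And>i. i \<in> I \<Longrightarrow> same_star_distribution \<psi> (b i) \<phi> a"
    and nm: "n \<ge> 1" "m \<ge> 1"
  shows "\<exists>C\<ge>0. \<forall>x\<in>finite_sums n I b. \<forall>y\<in>finite_sums n I b. norm2 \<psi> x \<le> R \<longrightarrow> norm2 \<psi> y \<le> R \<longrightarrow>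
    cmod (\<psi> ((x * star x) ^ m) - \<psi> ((y * star y) ^ m)) \<le> C * norm2 \<psi> (x - y)"
proof -
  define K where "K = (\<Sum>\<pi>\<in>NC_star n m. cmod (partition_cumulant \<phi> \<pi> (pattern_list a n m)))"
  define \<alpha> where "\<alpha> = norm2 \<phi> a ^ n"
  \<comment> \<open>There are \<open>2 * m\<close> telescoping terms. In each, one factor
    contributes \<open>norm2 \<psi> (x - y) / \<alpha>\<close> and the other
    \<open>2 * m - 1\<close> at most \<open>\<bar>R\<bar> / \<alpha>\<close>; the absolute value
    keeps \<open>C\<close> nonnegative for every \<open>R\<close>.\<close>
  define C where "C = (2 * real m) * (K * ((\<bar>R\<bar> / \<alpha>) ^ (2 * m - 1) / \<alpha>))"
  have \<alpha>: "\<alpha> > 0"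
    using norm2_pos[OF assms(1,2)] by (simp add: \<alpha>_def)
  have K: "K \<ge> 0"
    by (simp add: K_def sum_nonneg)
  have "cmod (\<psi> ((x * star x) ^ m) - \<psi> ((y * star y) ^ m)) \<le> C * norm2 \<psi> (x - y)"
    if x: "x \<in> finite_sums n I b" "norm2 \<psi> x \<le> R"
      and y: "y \<in> finite_sums n I b" "norm2 \<psi> y \<le> R" for x y
  proof -
    \<comment> \<open>Each telescoping term is again an alternating product of finite sums, one of
      them being \<open>x - y\<close>, so the multilinear bound applies to it.\<close>
    define X where "X i j = (if j < i then y else if j = i then x - y else x)" for i j :: nat
    let ?P = "\<lambda>i. prod_list (map (\<lambda>j. alt_star j (X i j)) [0..<2 * m])"
    let ?d = "norm2 \<psi> (x - y) / \<alpha>"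
    have "(x * star x) ^ m - (y * star y) ^ m = (\<Sum>i<2 * m. ?P i)"
      unfolding prod_list_alt_star[symmetric] prod_list_diff
      by (intro sum.cong refl arg_cong[where f = prod_list] map_cong) (simp add: X_def alt_star_diff)
    then have eq: "\<psi> ((x * star x) ^ m) - \<psi> ((y * star y) ^ m) = (\<Sum>i<2 * m. \<psi> (?P i))"
      using state_diff[OF assms(5)] state_sum[OF assms(5)] by metis
    have "cmod (\<psi> (?P i)) \<le> K * ((\<bar>R\<bar> / \<alpha>) ^ (2 * m - 1) * ?d)" if i: "i < 2 * m" for i
    proof -
      have "cmod (\<psi> (?P i)) \<le> K * (\<Prod>j<2 * m. norm2 \<psi> (X i j) / \<alpha>)"
        unfolding K_def \<alpha>_def
        by (rule alternating_moment_finite_sums_le[OF assms(1-5) _ nm])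
          (auto simp: dist X_def x y finite_sums_diff)
      also have "(\<Prod>j<2 * m. norm2 \<psi> (X i j) / \<alpha>) \<le> (\<Prod>j<2 * m. if j = i then ?d else \<bar>R\<bar> / \<alpha>)"
        using x y \<alpha> norm2_nonneg[OF assms(5)]
        by (intro prod_mono) (auto simp: X_def intro!: divide_right_mono)
      also have "\<dots> = ?d * (\<Prod>j\<in>{..<2 * m} - {i}. \<bar>R\<bar> / \<alpha>)"
        using i by (subst prod.remove[of _ i]) (auto intro!: prod.cong)
      also have "\<dots> = (\<bar>R\<bar> / \<alpha>) ^ (2 * m - 1) * ?d"
        using i by simp
      finally show ?thesis
        using K by (simp add: mult_left_mono)
    qed
    then have "cmod (\<Sum>i<2 * m. \<psi> (?P i)) \<le> (\<Sum>i<2 * m. K * ((\<bar>R\<bar> / \<alpha>) ^ (2 * m - 1) * ?d))"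
      by (intro sum_norm_le) auto
    then show ?thesis
      unfolding eq by (simp add: C_def mult_ac)
  qed
  moreover have "C \<ge> 0"
    using K \<alpha> by (simp add: C_def)
  ultimately show ?thesis
    by blast
qed

text \<open>Take all factors equal in the alternating bound and extract the root of order
  \<open>2 * m\<close>. Bounding the absolute value serves the Cauchy condition as well, where the
  norms of differences must tend to 0.\<close>

lemma even_norm_le:
  fixes \<psi> :: "'b::cstar_algebra \<Rightarrow> complex"
  assumes "faithful_state \<phi>" "a \<noteq> 0"
    and "R_diagonal \<phi> a" and "star_free \<psi> I b" and "faithful_state \<psi>"
    and dist: "\<And>i. i \<in> I \<Longrightarrow> same_star_distribution \<psi> (b i) \<phi> a"
    and nm: "n \<ge> 1" "m \<ge> 1"
    and x: "x \<in> finite_sums n I b"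
  shows "\<bar>even_norm \<psi> m x\<bar>
    \<le> root (2 * m) (\<Sum>\<pi>\<in>NC_star n m. cmod (partition_cumulant \<phi> \<pi> (pattern_list a n m)))
      * (1 / norm2 \<phi> a ^ n) * norm2 \<psi> x"
proof -
  define K where "K = (\<Sum>\<pi>\<in>NC_star n m. cmod (partition_cumulant \<phi> \<pi> (pattern_list a n m)))"
  let ?d = "norm2 \<psi> x / norm2 \<phi> a ^ n"
  have m0: "2 * m > 0"
    using nm by simp
  have d: "?d \<ge> 0"
    using norm2_pos[OF assms(1,2)] norm2_nonneg[OF assms(5), of x] by simp
  have "cmod (\<psi> (prod_list (map (\<lambda>j. alt_star j ((\<lambda>_. x) j)) [0..<2 * m]))) \<le> K * (\<Prod>j<2 * m. ?d)"
    unfolding K_def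
    by (rule alternating_moment_finite_sums_le[OF assms(1-5) _ nm]) (auto simp: dist x)
  then have "cmod (\<psi> ((x * star x) ^ m)) \<le> K * ?d ^ (2 * m)"
    by (simp add: prod_list_alt_star)
  then have "\<bar>Re (\<psi> ((x * star x) ^ m))\<bar> \<le> K * ?d ^ (2 * m)"
    using abs_Re_le_cmod order_trans by blast
  then have "root (2 * m) \<bar>Re (\<psi> ((x * star x) ^ m))\<bar> \<le> root (2 * m) (K * ?d ^ (2 * m))"
    using m0 by simp
  also have "\<dots> = root (2 * m) K * ?d"
    using m0 d by (simp add: real_root_mult real_root_power_cancel)
  finally show ?thesis
    using m0 by (simp add: even_norm_def K_def real_root_abs)
qed

section \<open>Passage to the closure\<close>

theorem lemma4p1:
  fixes \<phi> :: "'a::cstar_algebra \<Rightarrow> complex"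
    and \<psi> :: "'b::cstar_algebra \<Rightarrow> complex"
    and \<Lambda> :: "'b \<Rightarrow> 'h::banach"
    and a :: 'a and b :: "'i \<Rightarrow> 'b" and I :: "'i set"
    and n m :: nat and T :: 'h
  assumes "faithful_state \<phi>" and "a \<noteq> 0" and "R_diagonal \<phi> a"
    and "faithful_state \<psi>" and "L2_completion \<psi> \<Lambda>"
    and "star_free \<psi> I b" and "\<And>i. i \<in> I \<Longrightarrow> same_star_distribution \<psi> (b i) \<phi> a"
    and "n \<ge> 1" and "m \<ge> 1"
    and "T \<in> H_space \<Lambda> n I b"
  shows "\<exists>L. even_norm_limit \<psi> \<Lambda> (finite_sums n I b) m T L \<and>
     L \<le> root (2 * m) (\<Sum>\<pi>\<in>NC_star n m. cmod (partition_cumulant \<phi> \<pi> (pattern_list a n m)))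
         * (1 / norm2 \<phi> a ^ n) * norm T"
proof -
  let ?X = "finite_sums n I b" and ?F = "tending_to \<Lambda> (finite_sums n I b) T"
  define B where "B = root (2 * m) (\<Sum>\<pi>\<in>NC_star n m. cmod (partition_cumulant \<phi> \<pi> (pattern_list a n m)))
         * (1 / norm2 \<phi> a ^ n)"
  define h where "h x = \<psi> ((x * star x) ^ m)" for x
  have norm_\<Lambda>: "norm2 \<psi> x = norm (\<Lambda> x)" and \<Lambda>_diff: "\<Lambda> (x - y) = \<Lambda> x - \<Lambda> y" for x y
    using assms(5) by (auto simp: L2_completion_def linear_diff)
  have le: "\<bar>even_norm \<psi> m x\<bar> \<le> B * norm (\<Lambda> x)" if "x \<in> ?X" for x
    unfolding B_def norm_\<Lambda>[symmetric]
    by (rule even_norm_le[OF assms(1-3,6,4) _ assms(8,9) that]) (rule assms(7))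
  \<comment> \<open>The margin 1 ensures that finite sums close enough to \<open>T\<close> lie in
    the ball of radius \<open>R\<close>, on which the moment is Lipschitz.\<close>
  define R where "R = norm T + 1"
  have "\<exists>C\<ge>0. \<forall>x\<in>?X. \<forall>y\<in>?X. norm2 \<psi> x \<le> R \<longrightarrow> norm2 \<psi> y \<le> R \<longrightarrow>
    cmod (\<psi> ((x * star x) ^ m) - \<psi> ((y * star y) ^ m)) \<le> C * norm2 \<psi> (x - y)"
    by (rule even_moment_Lipschitz[OF assms(1-3,6,4) _ assms(8,9)]) (rule assms(7))
  then obtain C where C: "C \<ge> 0" and Lip: "\<And>x y. x \<in> ?X \<Longrightarrow> y \<in> ?X \<Longrightarrow> norm (\<Lambda> x) \<le> R \<Longrightarrow> norm (\<Lambda> y) \<le> R \<Longrightarrow>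
      cmod (h x - h y) \<le> C * norm (\<Lambda> x - \<Lambda> y)"
    unfolding norm_\<Lambda> \<Lambda>_diff h_def by blast

  have ev_X: "\<forall>\<^sub>F x in ?F. x \<in> ?X"
    unfolding tending_to_def by (simp add: eventually_inf_principal)
  have "filterlim \<Lambda> (nhds T) (filtercomap \<Lambda> (nhds T))"
    by (rule filterlim_filtercomap)
  then have lim_\<Lambda>: "(\<Lambda> \<longlongrightarrow> T) ?F"
    unfolding tending_to_def by (rule filterlim_mono) auto
  have bounded: "\<forall>\<^sub>F x in G. norm (f x) \<le> R" if "(f \<longlongrightarrow> T) G" for f :: "'c \<Rightarrow> 'h" and G
  proof -
    have "\<forall>\<^sub>F x in G. norm (f x) < R"
      using tendsto_norm[OF that] by (rule order_tendstoD) (simp add: R_def)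
    then show ?thesis
      by (rule eventually_mono) simp
  qed

  \<comment> \<open>One sequence of finite sums tending to \<open>T\<close> produces the candidate
    \<open>l\<close> for the limit of the moments.\<close>
  obtain t where "\<And>k. t k \<in> \<Lambda> ` ?X" and t: "t \<longlonglongrightarrow> T"
    using assms(10) unfolding H_space_def closure_sequential by blast
  then have "\<forall>k. \<exists>x. x \<in> ?X \<and> \<Lambda> x = t k"
    by (metis imageE)
  then obtain s where s: "\<And>k. s k \<in> ?X" "\<And>k. \<Lambda> (s k) = t k"
    by metis
  obtain N where N: "\<And>k. k \<ge> N \<Longrightarrow> norm (t k) \<le> R"
    using bounded[OF t] unfolding eventually_sequentially by blast
  have "Cauchy (\<lambda>k. h (s k))"
  proof (rule CauchyI)
    fix e :: real assume e: "e > 0"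
    \<comment> \<open>Dividing by \<open>C + 1\<close> covers the case \<open>C = 0\<close>.\<close>
    then have "e / (C + 1) > 0"
      using C by simp
    then obtain M where M: "\<And>k l. k \<ge> M \<Longrightarrow> l \<ge> M \<Longrightarrow> norm (t k - t l) < e / (C + 1)"
      using CauchyD[OF LIMSEQ_imp_Cauchy[OF t]] by blast
    have "cmod (h (s k) - h (s l)) < e" if "k \<ge> max M N" "l \<ge> max M N" for k l
    proof -
      have "cmod (h (s k) - h (s l)) \<le> C * norm (t k - t l)"
        using Lip[of "s k" "s l"] s N that by simp
      also have "\<dots> \<le> C * (e / (C + 1))"
        using M[of k l] that C by (intro mult_left_mono) auto
      also have "\<dots> < e"
        using C e by (simp add: field_simps)
      finally show ?thesis .
    qed
    then show "\<exists>M. \<forall>k\<ge>M. \<forall>l\<ge>M. cmod (h (s k) - h (s l)) < e"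
      by blast
  qed
  then obtain l where l: "(\<lambda>k. h (s k)) \<longlonglongrightarrow> l"
    using Cauchy_convergent_iff convergent_def by blast
  \<comment> \<open>Letting only the second argument of the Lipschitz estimate run along the
    sequence compares \<open>l\<close> with every nearby finite sum, so the moments converge along
    the whole filter.\<close>
  have "cmod (h x - l) \<le> C * norm (\<Lambda> x - T)" if x: "x \<in> ?X" "norm (\<Lambda> x) \<le> R" for x
  proof (rule LIMSEQ_le)
    show "(\<lambda>k. cmod (h x - h (s k))) \<longlonglongrightarrow> cmod (h x - l)"
      by (intro tendsto_intros l)
    show "(\<lambda>k. C * norm (\<Lambda> x - t k)) \<longlonglongrightarrow> C * norm (\<Lambda> x - T)"
      by (intro tendsto_intros t)
    show "\<exists>M. \<forall>k\<ge>M. cmod (h x - h (s k)) \<le> C * norm (\<Lambda> x - t k)"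
      using Lip[OF x(1) s(1) x(2)] s N by (intro exI[of _ N]) auto
  qed
  then have "\<forall>\<^sub>F x in ?F. norm (h x - l) \<le> C * norm (\<Lambda> x - T)"
    using eventually_conj[OF ev_X bounded[OF lim_\<Lambda>]] by (auto elim: eventually_mono)
  moreover have "((\<lambda>x. C * norm (\<Lambda> x - T)) \<longlongrightarrow> C * norm (T - T)) ?F"
    by (intro tendsto_intros lim_\<Lambda>)
  ultimately have "((\<lambda>x. h x - l) \<longlongrightarrow> 0) ?F"
    using Lim_null_comparison[of "\<lambda>x. h x - l"] by simp
  then have lim_h: "(h \<longlongrightarrow> l) ?F"
    by (rule LIM_zero_cancel)

  define L where "L = root (2 * m) (Re l)"
  have even_norm_h: "even_norm \<psi> m = (\<lambda>x. root (2 * m) (Re (h x)))"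
    by (simp add: even_norm_def h_def fun_eq_iff)
  have "(even_norm \<psi> m \<longlongrightarrow> L) ?F"
    unfolding even_norm_h L_def by (intro tendsto_intros lim_h)
  \<comment> \<open>A difference of finite sums is a finite sum, so the bound itself gives the
    Cauchy condition, with no triangle inequality for \<open>even_norm\<close>.\<close>
  moreover have "((\<lambda>(x, y). even_norm \<psi> m (x - y)) \<longlongrightarrow> 0) (?F \<times>\<^sub>F ?F)"
  proof (rule Lim_null_comparison)
    have "\<forall>\<^sub>F p in ?F \<times>\<^sub>F ?F. fst p \<in> ?X \<and> snd p \<in> ?X"
      using eventually_prodI[OF ev_X ev_X] .
    then show "\<forall>\<^sub>F p in ?F \<times>\<^sub>F ?F. norm (case p of (x, y) \<Rightarrow> even_norm \<psi> m (x - y))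
        \<le> B * norm (\<Lambda> (fst p) - \<Lambda> (snd p))"
      by (rule eventually_mono) (use le finite_sums_diff \<Lambda>_diff in \<open>force simp: case_prod_unfold\<close>)
    have "((\<lambda>p. B * norm (\<Lambda> (fst p) - \<Lambda> (snd p))) \<longlongrightarrow> B * norm (T - T)) (?F \<times>\<^sub>F ?F)"
      by (intro tendsto_intros filterlim_compose[OF lim_\<Lambda> filterlim_fst]
          filterlim_compose[OF lim_\<Lambda> filterlim_snd])
    then show "((\<lambda>p. B * norm (\<Lambda> (fst p) - \<Lambda> (snd p))) \<longlongrightarrow> 0) (?F \<times>\<^sub>F ?F)"
      by simp
  qed
  moreover have "L \<le> B * norm T"
  proof (rule LIMSEQ_le)
    show "(\<lambda>k. even_norm \<psi> m (s k)) \<longlonglongrightarrow> L"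
      unfolding even_norm_h L_def by (intro tendsto_intros l)
    show "(\<lambda>k. B * norm (t k)) \<longlonglongrightarrow> B * norm T"
      by (intro tendsto_intros t)
    show "\<exists>M. \<forall>k\<ge>M. even_norm \<psi> m (s k) \<le> B * norm (t k)"
      using le[OF s(1)] s(2) by (metis abs_le_D1)
  qed
  ultimately show ?thesis
    unfolding even_norm_limit_def B_def by blast
qed

end
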